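(* Let $n\ge 2$, let $\Omega\subset\mathbb{R}^n$ be a bounded convex domain, and let $p>n$. Suppose $u_0,u_1\in C(\overline\Omega)$ are non-trivial (i.e. not identically zero) convex Alexandrov solutions of the Dirichlet problem \[ \det D^2u=(-u)^p\quad\text{in }\Omega,\qquad u=0\quad\text{on }\partial\Omega . \] Then $u_0=u_1$ on $\overline\Omega$.
   Context: A convex domain is a nonempty open convex set; no smoothness or strict convexity of $\Omega$ is assumed. For a convex function $u$ on $\Omega$ and $x\in\Omega$, the subdifferential is $\partial u(x)=\{y\in\mathbb{R}^n: u(z)\ge u(x)+y\cdot(z-x)\ \text{for all } z\in\Omega\}$, and for $E\subset\Omega$ one sets $\partial u(E)=\bigcup_{x\in E}\partial u(x)$. The Alexandrov Monge--Ampère measure of $u$ is the Borel measure on $\Omega$ given by $\operatorname{MA}[u](E)=|\partial u(E)|$ (Lebesgue measure) for Borel sets $E\subset\Omega$. A convex function $u$ is an Alexandrov solution of $\det D^2u=f$ in $\Omega$ if $\operatorname{MA}[u]=f\,dx$ as measures on $\Omega$. A convex $u\in C(\overline\Omega)$ with $u=0$ on $\partial\Omega$ satisfies $u\le 0$, so $(-u)^p$ is well defined. *)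

theory Defs
  imports "HOL-Analysis.Analysis"
begin

definition convex_domain :: "'a::euclidean_space set \<Rightarrow> bool" where
  "convex_domain \<Omega> \<longleftrightarrow> \<Omega> \<noteq> {} \<and> open \<Omega> \<and> convex \<Omega>"

definition subdifferential :: "'a::euclidean_space set \<Rightarrow> ('a \<Rightarrow> real) \<Rightarrow> 'a \<Rightarrow> 'a set" where
  "subdifferential \<Omega> u x = {y. \<forall>z\<in>\<Omega>. u z \<ge> u x + y \<bullet> (z - x)}"

definition subdifferential_image :: "'a::euclidean_space set \<Rightarrow> ('a \<Rightarrow> real) \<Rightarrow> 'a set \<Rightarrow> 'a set" where
  "subdifferential_image \<Omega> u E = (\<Union>x\<in>E. subdifferential \<Omega> u x)"

text \<open>
  The set function below is meant for Borel sets \<open>E \<subseteq> \<Omega>\<close> with \<open>u\<close> convex on the open set \<open>\<Omega>\<close>.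
  For these the image of \<open>E\<close> under the subdifferential is Lebesgue measurable, but it need not be
  a Borel set; hence the completed measure \<^const>\<open>lebesgue\<close> rather than \<^const>\<open>lborel\<close>.
\<close>

definition monge_ampere :: "'a::euclidean_space set \<Rightarrow> ('a \<Rightarrow> real) \<Rightarrow> 'a set \<Rightarrow> ennreal" where
  "monge_ampere \<Omega> u E = emeasure lebesgue (subdifferential_image \<Omega> u E)"

text \<open>
  Equality of the two measures on \<open>\<Omega>\<close> is agreement on every Borel subset of \<open>\<Omega>\<close>. The right-hand
  side \<open>f\<close> is a nonnegative function, measurable on \<open>\<Omega>\<close>; its values outside \<open>\<Omega>\<close> are irrelevant.
\<close>

definition alexandrov_solution :: "'a::euclidean_space set \<Rightarrow> ('a \<Rightarrow> real) \<Rightarrow> ('a \<Rightarrow> real) \<Rightarrow> bool" where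
  "alexandrov_solution \<Omega> f u \<longleftrightarrow>
     convex_on \<Omega> u \<and>
     (\<forall>E. E \<in> sets borel \<and> E \<subseteq> \<Omega> \<longrightarrow>
        monge_ampere \<Omega> u E = (\<integral>\<^sup>+x\<in>E. ennreal (f x) \<partial>lborel))"

end

(* Let u* be the Legendre transform of u on the closure of the domain and h the support function of
   the domain. The Monge-Ampere energy of u is V(u) = integral of u* - h, which is linear in u*, while
   F(u) = integral of (-u)^(p+1) is, by Prekopa-Leindler, log-concave along paths that are linear in u*
   (these are infimal convolutions of the endpoints). Replace u1 by w = r u1 with V(w) = V(u0); it solves
   the equation with an extra constant factor. The equation says that the derivative of F at u0 along the
   path to w is at most (p+1)(V(w) - V(u0)) = 0, so F(w) <= F(u0), and equality by symmetry. The midpoint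
   of the path has the same F as its ends although it dominates the arithmetic, not just the geometric,
   means that Prekopa-Leindler needs. So the supporting planes of u0 and w with a common slope y can be
   chosen to touch at equal heights for every y. Along each ray this makes u0* - w* homogeneous of degree
   one, and being bounded it vanishes. Hence u0 = w, and p > n forces r = 1. *)

theory Submission
  imports Defs
begin

section \<open>The Prekopa-Leindler inequality\<close>

text \<open>Dilation is the freedom available for equalising V, and it changes the factor in front
  of (-u)^p. Solutions are therefore studied with an arbitrary positive factor, and the factors are
  compared after the functions have been identified.

  Two derivatives are avoided, since the gradient of a convex function is multivalued and F is not
  known to be differentiable along the path. The derivative of F at u0 becomes an inequality between
  integrals, obtained by comparing superlevel sets. The conclusion F(w) <= F(u0) then comes from two
  bounds at time s: F(w) > F(u0) would force growth linear in s by log-concavity, while Taylor's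
  formula allows only O(s^2).

  No classification of equality in Prekopa-Leindler is invoked. What is exploited is the strictness
  of the inequality between geometric and arithmetic means, and it says only that contact heights
  agree: the contact points may still differ. The missing information comes from an extra variable
  r: the common contact height at slope y/r is a subgradient in r of both r u0*(y/r) and r w*(y/r),
  so these differ by a constant; letting r tend to 0 shows that the constant is zero.\<close>

text \<open>A nonnegative value \<open>f x\<close> is the length of \<open>{0..<f x}\<close>, and
  Tonelli exchanges the two integrations. Negative values contribute nothing on either side.\<close>

lemma (in sigma_finite_measure) nn_integral_layer_cake:
  fixes f :: "'a \<Rightarrow> real"
  assumes [measurable]: "f \<in> borel_measurable M"
  shows "(\<integral>\<^sup>+x. ennreal (f x) \<partial>M) = (\<integral>\<^sup>+s\<in>{0..}. emeasure M {x\<in>space M. s < f x} \<partial>lborel)"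
proof -
  interpret P: pair_sigma_finite M "lborel :: real measure" ..
  have "ennreal (f x) = (\<integral>\<^sup>+s. indicator {0..} s * indicator {..<f x} s \<partial>lborel)" for x
  proof -
    have "(\<integral>\<^sup>+s. indicator {0..} s * indicator {..<f x} s \<partial>lborel) = emeasure lborel {0..<f x}"
      by (subst nn_integral_indicator[symmetric], simp, intro nn_integral_cong)
        (auto simp: indicator_def)
    then show ?thesis by (cases "0 \<le> f x") (auto simp: ennreal_neg)
  qed
  then have "(\<integral>\<^sup>+x. ennreal (f x) \<partial>M)
      = (\<integral>\<^sup>+x. \<integral>\<^sup>+s. indicator {0..} s * indicator {y. snd y < f (fst y)} (x, s) \<partial>lborel \<partial>M)"
    by (auto intro!: nn_integral_cong simp: indicator_def)
  also have "\<dots> = (\<integral>\<^sup>+s. \<integral>\<^sup>+x. indicator {0..} s * indicator {y. snd y < f (fst y)} (x, s) \<partial>M \<partial>lborel)"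
    by (rule P.Fubini'[symmetric]) measurable
  also have "\<dots> = (\<integral>\<^sup>+s\<in>{0..}. emeasure M {x\<in>space M. s < f x} \<partial>lborel)"
  proof (intro nn_integral_cong)
    fix s :: real
    have "(\<integral>\<^sup>+x. indicator {y. snd y < f (fst y)} (x, s) \<partial>M)
        = (\<integral>\<^sup>+x. indicator {x\<in>space M. s < f x} x \<partial>M)"
      by (intro nn_integral_cong) (auto simp: indicator_def)
    then show "(\<integral>\<^sup>+x. indicator {0..} s * indicator {y. snd y < f (fst y)} (x, s) \<partial>M)
        = emeasure M {x\<in>space M. s < f x} * indicator {0..} s"
      by (subst nn_integral_cmult) (auto simp: mult.commute)
  qed
  finally show ?thesis .
qed

text \<open>Integrals over unrelated spaces become comparable through the sizes of their superlevel
  sets. Later one space carries points and the other slopes.\<close>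

lemma nn_integral_mono_layer_cake:
  fixes f :: "'a \<Rightarrow> real" and g :: "'b \<Rightarrow> real"
  assumes "sigma_finite_measure M" "sigma_finite_measure N"
    and "f \<in> borel_measurable M" "g \<in> borel_measurable N"
    and le: "\<And>s. 0 \<le> s \<Longrightarrow> emeasure M {x\<in>space M. s < f x} \<le> emeasure N {y\<in>space N. s < g y}"
  shows "(\<integral>\<^sup>+x. ennreal (f x) \<partial>M) \<le> (\<integral>\<^sup>+y. ennreal (g y) \<partial>N)"
  using assms
  by (simp add: sigma_finite_measure.nn_integral_layer_cake)
    (auto intro!: nn_integral_mono simp: indicator_def)

section \<open>Brunn-Minkowski and Prekopa-Leindler on the line\<close>

text \<open>The translates of \<open>K\<close> by the least point of \<open>L\<close> and of
  \<open>L\<close> by the greatest point of \<open>K\<close> both lie in \<open>C\<close>. They meet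
  at most in \<open>Sup K + Inf L\<close>, so their measures add.\<close>

lemma emeasure_compact_sumset_real:
  fixes K L C :: "real set"
  assumes "compact K" "K \<noteq> {}" "compact L" "L \<noteq> {}" and C: "C \<in> sets lborel"
    and sub: "\<And>x y. x \<in> K \<Longrightarrow> y \<in> L \<Longrightarrow> x + y \<in> C"
  shows "emeasure lborel K + emeasure lborel L \<le> emeasure lborel C"
proof -
  have Sup: "Sup K \<in> K" and leSup: "\<And>x. x \<in> K \<Longrightarrow> x \<le> Sup K"
    using assms by (auto intro!: closed_contains_Sup compact_imp_closed cSup_upper
        bounded_imp_bdd_above compact_imp_bounded)
  have Inf: "Inf L \<in> L" and geInf: "\<And>x. x \<in> L \<Longrightarrow> Inf L \<le> x"
    using assms by (auto intro!: closed_contains_Inf compact_imp_closed cInf_lower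
        bounded_imp_bdd_below compact_imp_bounded)
  define A where "A = (+) (Inf L) ` K"
  define B where "B = (+) (Sup K) ` L"
  have cA: "compact A" and cB: "compact B"
    unfolding A_def B_def using assms by (auto intro!: compact_translation)
  have mA: "A \<in> sets lborel" and mB: "B \<in> sets lborel"
    using cA cB by (auto intro: borel_compact)
  have trans: "emeasure lborel ((+) c ` S) = emeasure lborel S" if "compact S" for c :: real and S
  proof -
    have "emeasure lebesgue ((+) c ` S) = emeasure lebesgue S"
      using emeasure_lebesgue_affine[of 1 c S] by (simp add: add.commute cong: image_cong)
    moreover have "(+) c ` S \<in> sets lborel" "S \<in> sets lborel"
      using that by (auto intro!: borel_compact compact_translation)
    ultimately show ?thesis by simp
  qed
  have "A \<inter> B \<subseteq> {Sup K + Inf L}"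
    unfolding A_def B_def using leSup geInf by (force simp: image_iff)
  then have null: "A \<inter> B \<in> null_sets lborel"
    by (intro finite_imp_null_set_lborel) (auto intro: finite_subset)
  have "emeasure lborel K + emeasure lborel L = emeasure lborel A + emeasure lborel B"
    using trans assms by (simp add: A_def B_def)
  also have "\<dots> = emeasure lborel (A \<union> B)"
    using mA mB null
    by (metis (no_types, opaque_lifting) Diff_Int2 Int_commute emeasure_Diff_null_set
        emeasure_Un inf.idem)
  also have "\<dots> \<le> emeasure lborel C"
    using sub[OF Sup] sub[OF _ Inf] by (intro emeasure_mono C) (auto simp: A_def B_def add.commute)
  finally show ?thesis .
qed


lemma emeasure_lborel_inner_compact:
  fixes A :: "'a::euclidean_space set"
  assumes A: "A \<in> sets lborel" "bounded A" and e: "0 < e"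
  obtains K where "compact K" "K \<subseteq> A" "emeasure lborel A \<le> emeasure lborel K + ennreal e"
proof -
  obtain K where K: "closed K" "K \<subseteq> A" "emeasure lebesgue (A - K) < ennreal e"
    using sets_lebesgue_inner_closed[OF sets_completionI_sets[OF A(1)] e] by metis
  have "compact K"
    using K A bounded_subset compact_eq_bounded_closed by blast
  moreover have "emeasure lborel A \<le> emeasure lborel K + ennreal e"
  proof -
    have "K \<in> sets lborel" using K by auto
    then have "emeasure lborel A = emeasure lborel K + emeasure lborel (A - K)"
      using A K plus_emeasure[of K lborel "A - K"] by (simp add: Un_absorb1)
    moreover have "emeasure lborel (A - K) \<le> ennreal e"
      using K(3) A \<open>K \<in> sets lborel\<close> by (simp add: less_imp_le)
    ultimately show ?thesis by (simp add: add_left_mono)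
  qed
  ultimately show ?thesis using that K by blast
qed

lemma emeasure_weighted_sumset_real:
  fixes A B C :: "real set"
  assumes A: "A \<in> sets lborel" "bounded A" "A \<noteq> {}"
    and B: "B \<in> sets lborel" "bounded B" "B \<noteq> {}"
    and C: "C \<in> sets lborel" and t: "0 < t" "t < 1"
    and sub: "\<And>x y. x \<in> A \<Longrightarrow> y \<in> B \<Longrightarrow> (1 - t) * x + t * y \<in> C"
  shows "ennreal (1 - t) * emeasure lborel A + ennreal t * emeasure lborel B \<le> emeasure lborel C"
proof (rule ennreal_le_epsilon)
  fix e :: real assume e: "0 < e"
  have scale: "emeasure lborel ((*) c ` S) = ennreal \<bar>c\<bar> * emeasure lborel S" if "compact S" for c :: real and S
  proof -
    have "emeasure lebesgue ((*) c ` S) = ennreal \<bar>c\<bar> * emeasure lebesgue S"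
      using emeasure_lebesgue_affine[of c 0 S] by simp
    moreover have "(*) c ` S \<in> sets lborel" "S \<in> sets lborel"
      using that compact_scaling[OF that, of c] by (auto intro!: borel_compact)
    ultimately show ?thesis by simp
  qed
  have inner: "\<exists>K. compact K \<and> K \<noteq> {} \<and> K \<subseteq> S \<and> emeasure lborel S \<le> emeasure lborel K + ennreal e"
    if S: "S \<in> sets lborel" "bounded S" "S \<noteq> {}" for S :: "real set"
  proof -
    obtain K where K: "compact K" "K \<subseteq> S" "emeasure lborel S \<le> emeasure lborel K + ennreal e"
      using emeasure_lborel_inner_compact[OF S(1,2) e] by metis
    \<comment> \<open>The approximating compact set may be empty when \<open>S\<close> is small,
      while the sumset inequality needs nonempty sets; one extra point repairs this.\<close>
    obtain x where x: "x \<in> S" using S by auto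
    have "emeasure lborel K \<le> emeasure lborel (insert x K)"
      using K by (intro emeasure_mono) (auto intro: borel_compact)
    then have "emeasure lborel S \<le> emeasure lborel (insert x K) + ennreal e"
      using K(3) by (meson add_right_mono order_trans)
    then show ?thesis using K x by (intro exI[of _ "insert x K"]) auto
  qed
  obtain K where K: "compact K" "K \<noteq> {}" "K \<subseteq> A" "emeasure lborel A \<le> emeasure lborel K + ennreal e"
    using inner A by blast
  obtain L where L: "compact L" "L \<noteq> {}" "L \<subseteq> B" "emeasure lborel B \<le> emeasure lborel L + ennreal e"
    using inner B by blast
  have "ennreal (1 - t) * emeasure lborel A + ennreal t * emeasure lborel B
      \<le> ennreal (1 - t) * (emeasure lborel K + ennreal e) + ennreal t * (emeasure lborel L + ennreal e)"
    using K L by (intro add_mono mult_left_mono) auto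
  also have "\<dots> = (ennreal (1 - t) * emeasure lborel K + ennreal t * emeasure lborel L)
      + (ennreal (1 - t) + ennreal t) * ennreal e"
    by (simp add: algebra_simps)
  also have "ennreal (1 - t) + ennreal t = 1"
    using t by (simp flip: ennreal_plus)
  also have "ennreal (1 - t) * emeasure lborel K + ennreal t * emeasure lborel L
      = emeasure lborel ((*) (1 - t) ` K) + emeasure lborel ((*) t ` L)"
    using scale K L t by simp
  also have "\<dots> \<le> emeasure lborel C"
    using K L compact_scaling[of K "1 - t"] compact_scaling[of L t] sub
    by (intro emeasure_compact_sumset_real C) auto
  finally show "ennreal (1 - t) * emeasure lborel A + ennreal t * emeasure lborel B
      \<le> emeasure lborel C + ennreal e"
    by (simp add: add_right_mono)
qed

lemma weighted_arith_geom_mean: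
  fixes x y t :: real
  assumes "0 \<le> x" "0 \<le> y" "0 < t" "t < 1"
  shows "x powr (1 - t) * y powr t \<le> (1 - t) * x + t * y"
  using Youngs_inequality_0[of "1 - t" t x y] assms by (cases "x = 0 \<or> y = 0") auto

lemma integrable_real_bounded_support:
  fixes k :: "real \<Rightarrow> real"
  assumes "k \<in> borel_measurable lborel" "\<And>x. 0 \<le> k x" "\<And>x. k x \<le> C" "\<And>x. k x \<noteq> 0 \<Longrightarrow> \<bar>x\<bar> \<le> R"
  shows "integrable lborel k"
proof (rule Bochner_Integration.integrable_bound)
  show "integrable lborel (\<lambda>x. C * indicator {-R..R} x :: real)"
    using emeasure_lborel_cbox_finite[of "-R" R]
    by (intro integrable_mult_right integrable_real_indicator) auto
  show "AE x in lborel. norm (k x) \<le> norm (C * indicator {-R..R} x :: real)"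
  proof (rule AE_I2)
    fix x show "norm (k x) \<le> norm (C * indicator {-R..R} x :: real)"
      using assms(2-4)[of x] by (cases "k x = 0") (auto simp: indicator_def abs_le_iff)
  qed
qed (fact assms(1))

text \<open>After division by the suprema \<alpha> and \<beta>, the superlevel sets of both
  functions are nonempty at every height below 1 and empty from 1 on, so the sumset inequality
  applies height by height. Integration over heights gives an arithmetic mean of the normalised
  integrals, which dominates the geometric one.\<close>

lemma prekopa_leindler_real:
  fixes f g h :: "real \<Rightarrow> real"
  assumes [measurable]: "f \<in> borel_measurable lborel" "g \<in> borel_measurable lborel"
    and h: "integrable lborel h"
    and nonneg: "\<And>x. 0 \<le> f x" "\<And>x. 0 \<le> g x" "\<And>x. 0 \<le> h x"
    and bd: "\<And>x. f x \<le> C" "\<And>x. g x \<le> C"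
    and supp: "\<And>x. f x \<noteq> 0 \<Longrightarrow> \<bar>x\<bar> \<le> R" "\<And>x. g x \<noteq> 0 \<Longrightarrow> \<bar>x\<bar> \<le> R"
    and t: "0 < t" "t < 1"
    and le: "\<And>x y. f x powr (1 - t) * g y powr t \<le> h ((1 - t) * x + t * y)"
  shows "integral\<^sup>L lborel f powr (1 - t) * integral\<^sup>L lborel g powr t \<le> integral\<^sup>L lborel h"
proof (cases "(\<forall>x. f x = 0) \<or> (\<forall>x. g x = 0)")
  case True
  then have "integral\<^sup>L lborel f = 0 \<or> integral\<^sup>L lborel g = 0"
    by (metis (no_types, lifting) Bochner_Integration.integral_cong integral_zero)
  moreover have "0 \<le> integral\<^sup>L lborel h" using nonneg by simp
  ultimately show ?thesis by auto
next
  case False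
  have [measurable]: "h \<in> borel_measurable lborel" using h by auto
  have intf: "integrable lborel f" and intg: "integrable lborel g"
    by (rule integrable_real_bounded_support[OF assms(1) nonneg(1) bd(1) supp(1)], assumption,
        rule integrable_real_bounded_support[OF assms(2) nonneg(2) bd(2) supp(2)], assumption)
  define \<alpha> where "\<alpha> = (SUP x. f x)"
  define \<beta> where "\<beta> = (SUP x. g x)"
  have bddf: "bdd_above (range f)" and bddg: "bdd_above (range g)"
    using bd by (auto intro!: bdd_aboveI[of _ C])
  have f\<alpha>: "f x \<le> \<alpha>" and g\<beta>: "g x \<le> \<beta>" for x
    unfolding \<alpha>_def \<beta>_def using bddf bddg by (auto intro: cSUP_upper)
  have \<alpha>: "0 < \<alpha>" and \<beta>: "0 < \<beta>"
    using False f\<alpha> g\<beta> nonneg by (metis order_le_less order_less_le_trans)+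
  define \<gamma> where "\<gamma> = \<alpha> powr (1 - t) * \<beta> powr t"
  have \<gamma>: "0 < \<gamma>" using \<alpha> \<beta> by (simp add: \<gamma>_def)
  have level: "ennreal (1 - t) * emeasure lborel {x. s < f x / \<alpha>} + ennreal t * emeasure lborel {x. s < g x / \<beta>}
      \<le> emeasure lborel {x. s < h x / \<gamma>}" if s: "0 \<le> s" for s :: real
  proof (cases "s < 1")
    case True
    obtain x where "s * \<alpha> < f x"
      using less_cSUP_iff[OF _ bddf, of "s * \<alpha>"] True \<alpha> by (auto simp: \<alpha>_def[symmetric])
    then have ne: "{x. s < f x / \<alpha>} \<noteq> {}" using \<alpha> by (auto simp: field_simps)
    obtain y where "s * \<beta> < g y"
      using less_cSUP_iff[OF _ bddg, of "s * \<beta>"] True \<beta> by (auto simp: \<beta>_def[symmetric])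
    then have ne': "{x. s < g x / \<beta>} \<noteq> {}" using \<beta> by (auto simp: field_simps)
    have "\<bar>x\<bar> \<le> R" if "s < f x / \<alpha>" for x
      by (rule supp(1)) (use that s in auto)
    moreover have "\<bar>x\<bar> \<le> R" if "s < g x / \<beta>" for x
      by (rule supp(2)) (use that s in auto)
    ultimately have "{x. s < f x / \<alpha>} \<subseteq> {-R..R}" "{x. s < g x / \<beta>} \<subseteq> {-R..R}"
      by (auto simp: abs_le_iff minus_le_iff)
    then have bb: "bounded {x. s < f x / \<alpha>}" "bounded {x. s < g x / \<beta>}"
      using bounded_closed_interval bounded_subset by blast+
    have "s < h ((1 - t) * x + t * y) / \<gamma>" if x: "s < f x / \<alpha>" and y: "s < g y / \<beta>" for x y
    proof -
      have "s = s powr (1 - t) * s powr t"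
        using s by (cases "s = 0") (auto simp flip: powr_add)
      also have "\<dots> < (f x / \<alpha>) powr (1 - t) * (g y / \<beta>) powr t"
        using x y s t by (intro mult_strict_mono' powr_less_mono2) auto
      also have "\<dots> = f x powr (1 - t) * g y powr t / \<gamma>"
        using nonneg \<alpha> \<beta> by (simp add: \<gamma>_def powr_divide)
      also have "\<dots> \<le> h ((1 - t) * x + t * y) / \<gamma>"
        using le \<gamma> by (simp add: divide_right_mono)
      finally show ?thesis .
    qed
    then show ?thesis
      by (intro emeasure_weighted_sumset_real ne ne' bb t) auto
  next
    case False
    have "f x / \<alpha> \<le> s" "g x / \<beta> \<le> s" for x
      using False f\<alpha>[of x] g\<beta>[of x] \<alpha> \<beta>
      by (auto intro: order_trans[of _ 1] simp: divide_le_eq_1)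
    then have "{x. s < f x / \<alpha>} = {}" "{x. s < g x / \<beta>} = {}"
      by (auto simp: not_less)
    then show ?thesis by simp
  qed
  have "ennreal ((1 - t) * (integral\<^sup>L lborel f / \<alpha>) + t * (integral\<^sup>L lborel g / \<beta>))
      = ennreal (1 - t) * (\<integral>\<^sup>+x. ennreal (f x / \<alpha>) \<partial>lborel) + ennreal t * (\<integral>\<^sup>+x. ennreal (g x / \<beta>) \<partial>lborel)"
    using intf intg nonneg \<alpha> \<beta> t
    by (simp add: nn_integral_eq_integral ennreal_mult'[symmetric] ennreal_plus[symmetric] del: ennreal_plus)
  also have "\<dots> = (\<integral>\<^sup>+s\<in>{0..}. (ennreal (1 - t) * emeasure lborel {x. s < f x / \<alpha>}
      + ennreal t * emeasure lborel {x. s < g x / \<beta>}) \<partial>lborel)"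
    by (simp add: lborel.nn_integral_layer_cake nn_integral_cmult nn_integral_add distrib_right mult.assoc)
  also have "\<dots> \<le> (\<integral>\<^sup>+s\<in>{0..}. emeasure lborel {x. s < h x / \<gamma>} \<partial>lborel)"
    using level by (intro nn_integral_mono) (auto simp: indicator_def)
  also have "\<dots> = (\<integral>\<^sup>+x. ennreal (h x / \<gamma>) \<partial>lborel)"
    by (simp add: lborel.nn_integral_layer_cake)
  also have "\<dots> = ennreal (integral\<^sup>L lborel h / \<gamma>)"
    using h nonneg \<gamma> by (simp add: nn_integral_eq_integral)
  finally have "(1 - t) * (integral\<^sup>L lborel f / \<alpha>) + t * (integral\<^sup>L lborel g / \<beta>) \<le> integral\<^sup>L lborel h / \<gamma>"
    using nonneg \<gamma> by (subst (asm) ennreal_le_iff) auto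
  moreover have "(integral\<^sup>L lborel f / \<alpha>) powr (1 - t) * (integral\<^sup>L lborel g / \<beta>) powr t
      \<le> (1 - t) * (integral\<^sup>L lborel f / \<alpha>) + t * (integral\<^sup>L lborel g / \<beta>)"
    using nonneg \<alpha> \<beta> t by (intro weighted_arith_geom_mean) auto
  moreover have "(integral\<^sup>L lborel f / \<alpha>) powr (1 - t) * (integral\<^sup>L lborel g / \<beta>) powr t
      = integral\<^sup>L lborel f powr (1 - t) * integral\<^sup>L lborel g powr t / \<gamma>"
    using nonneg \<alpha> \<beta> by (simp add: \<gamma>_def powr_divide)
  ultimately have "integral\<^sup>L lborel f powr (1 - t) * integral\<^sup>L lborel g powr t / \<gamma>
      \<le> integral\<^sup>L lborel h / \<gamma>"
    by linarith
  then show ?thesis using \<gamma> by (simp add: divide_le_cancel)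
qed

section \<open>Prekopa-Leindler in several variables\<close>

text \<open>The class is made for induction on coordinates: integrating out one of them keeps the
  cube of side \<open>2 * R\<close> and multiplies the bound \<open>C\<close> by
  \<open>2 * R\<close>. Membership also supplies all integrability.\<close>

definition box_function :: "'i set \<Rightarrow> real \<Rightarrow> real \<Rightarrow> (('i \<Rightarrow> real) \<Rightarrow> real) \<Rightarrow> bool" where
  "box_function I R C f \<longleftrightarrow> f \<in> borel_measurable (\<Pi>\<^sub>M i\<in>I. lborel) \<and>
     (\<forall>x\<in>space (\<Pi>\<^sub>M i\<in>I. lborel). 0 \<le> f x \<and> f x \<le> C \<and> (f x \<noteq> 0 \<longrightarrow> (\<forall>i\<in>I. \<bar>x i\<bar> \<le> R)))"

lemma box_function_integrable:
  assumes "finite I" "box_function I R C f"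
  shows "integrable (\<Pi>\<^sub>M i\<in>I. lborel) f"
proof (rule Bochner_Integration.integrable_bound)
  interpret finite_product_sigma_finite "\<lambda>_. lborel :: real measure" I
    by standard fact
  let ?B = "\<Pi>\<^sub>E i\<in>I. {-R..R}"
  have B: "?B \<in> sets (\<Pi>\<^sub>M i\<in>I. lborel)"
    using assms by (intro sets_PiM_I_finite) auto
  have "emeasure (\<Pi>\<^sub>M i\<in>I. lborel) ?B = (\<Prod>i\<in>I. emeasure lborel {-R..R})"
    using assms by (intro measure_times) auto
  also have "\<dots> < \<infinity>"
    by (simp add: emeasure_lborel_Icc_eq ennreal_power)
  finally show "integrable (\<Pi>\<^sub>M i\<in>I. lborel) (\<lambda>x. C * indicator ?B x :: real)"
    using B by (intro integrable_mult_right integrable_real_indicator)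
  show "AE x in \<Pi>\<^sub>M i\<in>I. lborel. norm (f x) \<le> norm (C * indicator ?B x :: real)"
  proof (rule AE_I2)
    fix x assume x: "x \<in> space (\<Pi>\<^sub>M i\<in>I. lborel :: real measure)"
    show "norm (f x) \<le> norm (C * indicator ?B x :: real)"
    proof (cases "f x = 0")
      case False
      then have "x \<in> ?B"
        using assms(2) x by (auto simp: box_function_def space_PiM PiE_iff abs_le_iff minus_le_iff)
      moreover have "0 \<le> f x" "f x \<le> C"
        using assms(2) x by (simp_all add: box_function_def)
      ultimately show ?thesis by simp
    qed simp
  qed
  show "f \<in> borel_measurable (\<Pi>\<^sub>M i\<in>I. lborel)"
    using assms by (simp add: box_function_def)
qed

lemma box_function_section:
  assumes f: "box_function (insert i I) R C f" and i: "i \<notin> I"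
    and x: "x \<in> space (\<Pi>\<^sub>M i\<in>I. lborel :: real measure)"
  shows "(\<lambda>y. f (x(i := y))) \<in> borel_measurable lborel"
    and "0 \<le> f (x(i := y))" and "f (x(i := y)) \<le> C"
    and "f (x(i := y)) \<noteq> 0 \<Longrightarrow> \<bar>y\<bar> \<le> R"
    and "f (x(i := y)) \<noteq> 0 \<Longrightarrow> j \<in> I \<Longrightarrow> \<bar>x j\<bar> \<le> R"
proof -
  have sp: "x(i := y) \<in> space (\<Pi>\<^sub>M i\<in>insert i I. lborel :: real measure)" for y
    using x by (auto simp: space_PiM PiE_iff extensional_def)
  have fm: "f \<in> borel_measurable (\<Pi>\<^sub>M i\<in>insert i I. lborel)"
    using f by (simp add: box_function_def)
  show "(\<lambda>y. f (x(i := y))) \<in> borel_measurable lborel"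
    using measurable_comp[OF measurable_component_update[OF x i] fm] by (simp add: comp_def)
  show "0 \<le> f (x(i := y))" "f (x(i := y)) \<le> C" "f (x(i := y)) \<noteq> 0 \<Longrightarrow> \<bar>y\<bar> \<le> R"
    using f sp[of y] unfolding box_function_def by (fastforce, fastforce, fastforce)
  show "\<bar>x j\<bar> \<le> R" if "f (x(i := y)) \<noteq> 0" "j \<in> I"
  proof -
    have "\<bar>(x(i := y)) j\<bar> \<le> R"
      using f sp[of y] that unfolding box_function_def by blast
    moreover have "j \<noteq> i" using i that by auto
    ultimately show ?thesis by simp
  qed
qed

lemma box_function_integrate:
  assumes f: "box_function (insert i I) R C f" and i: "i \<notin> I" and R: "0 \<le> R"
  shows "box_function I R (C * (2 * R)) (\<lambda>x. \<integral>y. f (x(i := y)) \<partial>lborel)"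
  unfolding box_function_def
proof (intro conjI ballI impI)
  have fm: "f \<in> borel_measurable (\<Pi>\<^sub>M i\<in>insert i I. lborel)"
    using f by (simp add: box_function_def)
  have "(\<lambda>(x, y). f (x(i := y))) \<in> borel_measurable ((\<Pi>\<^sub>M i\<in>I. lborel) \<Otimes>\<^sub>M (lborel :: real measure))"
    using measurable_comp[OF measurable_add_dim fm] by (simp add: comp_def case_prod_unfold)
  then show "(\<lambda>x. \<integral>y. f (x(i := y)) \<partial>lborel) \<in> borel_measurable (\<Pi>\<^sub>M i\<in>I. lborel)"
    by (rule lborel.borel_measurable_lebesgue_integral)
  fix x assume x: "x \<in> space (\<Pi>\<^sub>M i\<in>I. lborel :: real measure)"
  note s = box_function_section[OF f i x]
  show "0 \<le> (\<integral>y. f (x(i := y)) \<partial>lborel)"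
    using s by (intro Bochner_Integration.integral_nonneg) auto
  have "(\<integral>y. f (x(i := y)) \<partial>lborel) \<le> (\<integral>y. C * indicator {-R..R} y \<partial>lborel)"
  proof (rule integral_mono)
    show "integrable lborel (\<lambda>y. f (x(i := y)))"
      by (rule integrable_real_bounded_support[OF s(1-3)]) (use s(4) in blast)
    show "integrable lborel (\<lambda>y. C * indicator {-R..R} y :: real)"
      using emeasure_lborel_cbox_finite[of "-R" R]
      by (intro integrable_mult_right integrable_real_indicator) auto
    show "f (x(i := y)) \<le> C * indicator {-R..R} y" for y
    proof (cases "f (x(i := y)) = 0")
      case True
      then show ?thesis using s(2,3)[of y] by (simp add: indicator_def)
    next
      case False
      then show ?thesis using s(3,4)[of y] by (simp add: indicator_def abs_le_iff)
    qed
  qed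
  also have "\<dots> = C * (2 * R)" using R by simp
  finally show "(\<integral>y. f (x(i := y)) \<partial>lborel) \<le> C * (2 * R)" .
  fix j assume nz: "(\<integral>y. f (x(i := y)) \<partial>lborel) \<noteq> 0" and j: "j \<in> I"
  have "\<exists>y. f (x(i := y)) \<noteq> 0"
  proof (rule ccontr)
    assume "\<nexists>y. f (x(i := y)) \<noteq> 0"
    then show False using nz by simp
  qed
  then show "\<bar>x j\<bar> \<le> R" using s(5) j by blast
qed

text \<open>For fixed remaining coordinates \<open>x\<close> and \<open>y\<close>, the inequality on
  the line, applied to the sections in the new coordinate, is exactly the hypothesis for the
  functions with that coordinate integrated out.\<close>

lemma prekopa_leindler_PiM:
  fixes f g h :: "('i \<Rightarrow> real) \<Rightarrow> real"
  assumes "finite I" and t: "0 < t" "t < 1" and R: "0 \<le> R"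
    and "box_function I R C f" "box_function I R C g" "box_function I R C h"
    and "\<And>x y. x \<in> space (\<Pi>\<^sub>M i\<in>I. lborel :: real measure) \<Longrightarrow> y \<in> space (\<Pi>\<^sub>M i\<in>I. lborel :: real measure) \<Longrightarrow>
      f x powr (1 - t) * g y powr t \<le> h (\<lambda>i\<in>I. (1 - t) * x i + t * y i)"
  shows "integral\<^sup>L (\<Pi>\<^sub>M i\<in>I. lborel) f powr (1 - t) * integral\<^sup>L (\<Pi>\<^sub>M i\<in>I. lborel) g powr t
      \<le> integral\<^sup>L (\<Pi>\<^sub>M i\<in>I. lborel) h"
  using assms(1,5-8)
proof (induction I arbitrary: f g h C rule: finite_induct)
  case empty
  have "integral\<^sup>L (\<Pi>\<^sub>M i\<in>{}. lborel :: real measure) k = k (\<lambda>_. undefined)" for k :: "('i \<Rightarrow> real) \<Rightarrow> real"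
    by (simp add: PiM_empty lebesgue_integral_count_space_finite)
  moreover have "(\<lambda>i\<in>{}. (1 - t) * (undefined :: real) + t * undefined) = (\<lambda>_::'i. undefined)"
    by (auto simp: restrict_def)
  ultimately show ?case
    using empty(4)[of "\<lambda>_. undefined" "\<lambda>_. undefined"] by (simp add: space_PiM)
next
  case (insert i I)
  interpret product_sigma_finite "\<lambda>_. lborel :: real measure" by standard
  have eq: "integral\<^sup>L (\<Pi>\<^sub>M i\<in>insert i I. lborel) k = (\<integral>x. (\<integral>y. k (x(i := y)) \<partial>lborel) \<partial>(\<Pi>\<^sub>M i\<in>I. lborel))"
    if "box_function (insert i I) R C k" for k :: "('i \<Rightarrow> real) \<Rightarrow> real"
    using insert.hyps that by (intro product_integral_insert box_function_integrable) auto
  show ?case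
    unfolding eq[OF insert.prems(1)] eq[OF insert.prems(2)] eq[OF insert.prems(3)]
  proof (rule insert.IH[where C = "C * (2 * R)"])
    fix x y assume x: "x \<in> space (\<Pi>\<^sub>M i\<in>I. lborel :: real measure)"
      and y: "y \<in> space (\<Pi>\<^sub>M i\<in>I. lborel :: real measure)"
    let ?z = "\<lambda>i\<in>I. (1 - t) * x i + t * y i"
    have z: "?z \<in> space (\<Pi>\<^sub>M i\<in>I. lborel :: real measure)"
      by (auto simp: space_PiM)
    note sf = box_function_section[OF insert.prems(1) insert.hyps(2) x]
    note sg = box_function_section[OF insert.prems(2) insert.hyps(2) y]
    note sh = box_function_section[OF insert.prems(3) insert.hyps(2) z]
    show "(\<integral>v. f (x(i := v)) \<partial>lborel) powr (1 - t) * (\<integral>v. g (y(i := v)) \<partial>lborel) powr t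
        \<le> (\<integral>v. h (?z(i := v)) \<partial>lborel)"
    proof (rule prekopa_leindler_real[OF sf(1) sg(1) _ sf(2) sg(2) sh(2) sf(3) sg(3) sf(4) sg(4) t])
      show "integrable lborel (\<lambda>v. h (?z(i := v)))"
        by (rule integrable_real_bounded_support[OF sh(1-3)]) (use sh(4) in blast)
      fix v w :: real
      have "x(i := v) \<in> space (\<Pi>\<^sub>M i\<in>insert i I. lborel :: real measure)"
        "y(i := w) \<in> space (\<Pi>\<^sub>M i\<in>insert i I. lborel :: real measure)"
        using x y by (auto simp: space_PiM PiE_iff extensional_def)
      from insert.prems(4)[OF this]
      have "f (x(i := v)) powr (1 - t) * g (y(i := w)) powr t
          \<le> h (\<lambda>j\<in>insert i I. (1 - t) * (x(i := v)) j + t * (y(i := w)) j)" .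
      also have "(\<lambda>j\<in>insert i I. (1 - t) * (x(i := v)) j + t * (y(i := w)) j) = ?z(i := (1 - t) * v + t * w)"
        using insert.hyps by (auto simp: restrict_def fun_eq_iff)
      finally show "f (x(i := v)) powr (1 - t) * g (y(i := w)) powr t
          \<le> h (?z(i := (1 - t) * v + t * w))" .
    qed
  qed (intro box_function_integrate insert.prems insert.hyps R)+
qed

theorem prekopa_leindler:
  fixes f g h :: "'a::euclidean_space \<Rightarrow> real"
  assumes meas: "f \<in> borel_measurable borel" "g \<in> borel_measurable borel" "h \<in> borel_measurable borel"
    and nonneg: "\<And>x. 0 \<le> f x" "\<And>x. 0 \<le> g x" "\<And>x. 0 \<le> h x"
    and bd: "\<And>x. f x \<le> C" "\<And>x. g x \<le> C" "\<And>x. h x \<le> C"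
    and supp: "\<And>x. f x \<noteq> 0 \<Longrightarrow> norm x \<le> R" "\<And>x. g x \<noteq> 0 \<Longrightarrow> norm x \<le> R" "\<And>x. h x \<noteq> 0 \<Longrightarrow> norm x \<le> R"
    and t: "0 < t" "t < 1"
    and le: "\<And>x y. f x powr (1 - t) * g y powr t \<le> h ((1 - t) *\<^sub>R x + t *\<^sub>R y)"
  shows "integral\<^sup>L lborel f powr (1 - t) * integral\<^sup>L lborel g powr t \<le> integral\<^sup>L lborel h"
proof -
  define T :: "('a \<Rightarrow> real) \<Rightarrow> 'a" where "T = (\<lambda>\<phi>. \<Sum>b\<in>Basis. \<phi> b *\<^sub>R b)"
  have T: "T \<in> (\<Pi>\<^sub>M b\<in>Basis. lborel) \<rightarrow>\<^sub>M borel"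
    unfolding T_def by measurable
  have T_inner: "T \<phi> \<bullet> b = \<phi> b" if "b \<in> Basis" for \<phi> b
    using that by (simp add: T_def inner_sum_left inner_Basis if_distrib cong: if_cong)
  have eq: "integral\<^sup>L lborel k = integral\<^sup>L (\<Pi>\<^sub>M b\<in>Basis. lborel) (\<lambda>\<phi>. k (T \<phi>))"
    if "k \<in> borel_measurable borel" for k :: "'a \<Rightarrow> real"
    by (subst lborel_eq) (simp add: integral_distr T that T_def[symmetric])
  \<comment> \<open>A negative \<open>R\<close> is possible if all three functions vanish, whereas
    the induction needs a nonnegative side length.\<close>
  have box: "box_function Basis (max 0 R) C (\<lambda>\<phi>. k (T \<phi>))"
    if k: "k \<in> borel_measurable borel" "\<And>x. 0 \<le> k x" "\<And>x. k x \<le> C" "\<And>x. k x \<noteq> 0 \<Longrightarrow> norm x \<le> R"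
    for k :: "'a \<Rightarrow> real"
    unfolding box_function_def
  proof (intro conjI ballI impI)
    show "(\<lambda>\<phi>. k (T \<phi>)) \<in> borel_measurable (\<Pi>\<^sub>M b\<in>Basis. lborel)"
      using T k(1) by measurable
    fix \<phi> :: "'a \<Rightarrow> real" and b :: 'a
    show "0 \<le> k (T \<phi>)" "k (T \<phi>) \<le> C" using k by auto
    assume "k (T \<phi>) \<noteq> 0" and b: "b \<in> Basis"
    then have "norm (T \<phi>) \<le> R" using k by auto
    then show "\<bar>\<phi> b\<bar> \<le> max 0 R"
      using Basis_le_norm[OF b, of "T \<phi>"] T_inner[OF b, of \<phi>] by auto
  qed
  have "integral\<^sup>L (\<Pi>\<^sub>M b\<in>Basis. lborel) (\<lambda>\<phi>. f (T \<phi>)) powr (1 - t)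
      * integral\<^sup>L (\<Pi>\<^sub>M b\<in>Basis. lborel) (\<lambda>\<phi>. g (T \<phi>)) powr t
      \<le> integral\<^sup>L (\<Pi>\<^sub>M b\<in>Basis. lborel) (\<lambda>\<phi>. h (T \<phi>))"
  proof (rule prekopa_leindler_PiM[OF finite_Basis t, of "max 0 R"])
    fix x y :: "'a \<Rightarrow> real"
    have "T (\<lambda>i\<in>Basis. (1 - t) * x i + t * y i) = (1 - t) *\<^sub>R T x + t *\<^sub>R T y"
      by (rule euclidean_eqI) (simp add: T_inner inner_add_left)
    then show "f (T x) powr (1 - t) * g (T y) powr t \<le> h (T (\<lambda>i\<in>Basis. (1 - t) * x i + t * y i))"
      using le by simp
  qed (use box[OF meas(1) nonneg(1) bd(1) supp(1)] box[OF meas(2) nonneg(2) bd(2) supp(2)]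
      box[OF meas(3) nonneg(3) bd(3) supp(3)] in auto)
  then show ?thesis by (simp add: eq meas)
qed

section \<open>Conjugates and solutions with a power right-hand side\<close>

definition conjugate :: "'a::euclidean_space set \<Rightarrow> ('a \<Rightarrow> real) \<Rightarrow> 'a \<Rightarrow> real" where
  "conjugate \<Omega> u y = (SUP x\<in>closure \<Omega>. x \<bullet> y - u x)"

text \<open>Collects what makes the supremum in \<open>conjugate\<close> attained. The zero function
  is an instance too, and its conjugate is the support function of the domain.\<close>

locale conjugable =
  fixes \<Omega> :: "'a::euclidean_space set" and u :: "'a \<Rightarrow> real"
  assumes bounded_domain: "bounded \<Omega>" and nonempty: "\<Omega> \<noteq> {}"
    and cont: "continuous_on (closure \<Omega>) u"
begin

lemma compact_closure_domain: "compact (closure \<Omega>)"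
  using bounded_domain by (rule compact_closure[THEN iffD2])

lemma conjugate_attained:
  obtains x where "x \<in> closure \<Omega>" "conjugate \<Omega> u y = x \<bullet> y - u x"
    "\<And>z. z \<in> closure \<Omega> \<Longrightarrow> z \<bullet> y - u z \<le> x \<bullet> y - u x"
proof -
  have "continuous_on (closure \<Omega>) (\<lambda>x. x \<bullet> y - u x)"
    by (intro continuous_intros cont)
  moreover have "closure \<Omega> \<noteq> {}" using nonempty by simp
  ultimately obtain x where x: "x \<in> closure \<Omega>" "\<forall>z\<in>closure \<Omega>. z \<bullet> y - u z \<le> x \<bullet> y - u x"
    using continuous_attains_sup[OF compact_closure_domain] by blast
  then have "conjugate \<Omega> u y = x \<bullet> y - u x"
    unfolding conjugate_def by (intro cSup_eq_maximum) auto
  then show ?thesis using that x by blast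
qed

lemma conjugate_ge: "x \<in> closure \<Omega> \<Longrightarrow> x \<bullet> y - u x \<le> conjugate \<Omega> u y"
  by (metis conjugate_attained)

lemma conjugate_le: "(\<And>x. x \<in> closure \<Omega> \<Longrightarrow> x \<bullet> y - u x \<le> b) \<Longrightarrow> conjugate \<Omega> u y \<le> b"
  by (metis conjugate_attained)

text \<open>Equality in the Young-Fenchel inequality: the subgradient inequality on
  \<open>\<Omega>\<close> extends to the closure by continuity.\<close>

lemma conjugate_subdifferential:
  assumes x: "x \<in> \<Omega>" and y: "y \<in> subdifferential \<Omega> u x"
  shows "conjugate \<Omega> u y = x \<bullet> y - u x"
proof (rule antisym)
  show "conjugate \<Omega> u y \<le> x \<bullet> y - u x"
  proof (rule conjugate_le)
    fix z assume z: "z \<in> closure \<Omega>"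
    have "z \<bullet> y - u z \<le> x \<bullet> y - u x"
    proof (rule continuous_le_on_closure[OF _ z])
      show "continuous_on (closure \<Omega>) (\<lambda>z. z \<bullet> y - u z)"
        by (intro continuous_intros cont)
      fix v assume "v \<in> \<Omega>"
      then have "u v \<ge> u x + y \<bullet> (v - x)"
        using y by (auto simp: subdifferential_def)
      then show "v \<bullet> y - u v \<le> x \<bullet> y - u x"
        by (simp add: inner_diff_right inner_commute)
    qed
    then show "z \<bullet> y - u z \<le> x \<bullet> y - u x" .
  qed
  show "x \<bullet> y - u x \<le> conjugate \<Omega> u y"
    using x closure_subset by (intro conjugate_ge) auto
qed

lemma subdifferential_of_attained:
  assumes "x \<in> \<Omega>" "conjugate \<Omega> u y = x \<bullet> y - u x"
  shows "y \<in> subdifferential \<Omega> u x"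
  unfolding subdifferential_def
proof safe
  fix z assume "z \<in> \<Omega>"
  then have "z \<bullet> y - u z \<le> x \<bullet> y - u x"
    using conjugate_ge[of z y] assms closure_subset by auto
  then show "u x + y \<bullet> (z - x) \<le> u z"
    by (simp add: inner_diff_right inner_commute)
qed

lemma conjugate_diff_le:
  assumes "\<And>x. x \<in> closure \<Omega> \<Longrightarrow> norm x \<le> r"
  shows "conjugate \<Omega> u y - conjugate \<Omega> u y' \<le> r * norm (y - y')"
proof -
  obtain x where x: "x \<in> closure \<Omega>" "conjugate \<Omega> u y = x \<bullet> y - u x"
    by (rule conjugate_attained)
  have "conjugate \<Omega> u y - conjugate \<Omega> u y' \<le> x \<bullet> (y - y')"
    using conjugate_ge[OF x(1), of y'] x(2) by (simp add: inner_diff_right)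
  also have "\<dots> \<le> norm x * norm (y - y')"
    by (rule norm_cauchy_schwarz)
  also have "\<dots> \<le> r * norm (y - y')"
    using assms[OF x(1)] by (intro mult_right_mono) auto
  finally show ?thesis .
qed

lemma conjugate_continuous: "continuous_on UNIV (conjugate \<Omega> u)"
proof -
  obtain r where r: "\<And>x. x \<in> closure \<Omega> \<Longrightarrow> norm x \<le> r"
    using compact_imp_bounded[OF compact_closure_domain] unfolding bounded_iff by blast
  obtain z where "z \<in> closure \<Omega>" using nonempty closure_subset by blast
  then have "0 \<le> r" using r[of z] norm_ge_zero[of z] by linarith
  then have "r-lipschitz_on UNIV (conjugate \<Omega> u)"
  proof (rule lipschitz_onI[rotated])
    fix y y' :: 'a
    show "dist (conjugate \<Omega> u y) (conjugate \<Omega> u y') \<le> r * dist y y'"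
      using conjugate_diff_le[OF r, of y y'] conjugate_diff_le[OF r, of y' y]
      by (simp add: dist_norm abs_le_iff norm_minus_commute[of y' y])
  qed
  then show ?thesis by (rule lipschitz_on_continuous_on)
qed

end

text \<open>The conjugate itself is not integrable. Subtracting the support function leaves a
  bounded nonnegative function that vanishes at slopes not attained inside the domain.\<close>

definition conjugate_gap :: "'a::euclidean_space set \<Rightarrow> ('a \<Rightarrow> real) \<Rightarrow> 'a \<Rightarrow> real" where
  "conjugate_gap \<Omega> u y = conjugate \<Omega> u y - conjugate \<Omega> (\<lambda>_. 0) y"

text \<open>For a solution this is \<open>1 / (n + 1)\<close> times the integral of \<open>- u\<close> against its Monge-Ampere measure;
  the form below is affine in the conjugate.\<close>

definition conjugate_volume :: "'a::euclidean_space set \<Rightarrow> ('a \<Rightarrow> real) \<Rightarrow> real" where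
  "conjugate_volume \<Omega> u = (\<integral>y. conjugate_gap \<Omega> u y \<partial>lborel)"

section \<open>Sign, Monge-Ampere measure and conjugate gap of one solution\<close>

text \<open>The factor \<open>c\<close> makes the class stable under multiplication of
  \<open>u\<close> by positive constants.\<close>

locale power_solution =
  fixes \<Omega> :: "'a::euclidean_space set" and p c :: real and u :: "'a \<Rightarrow> real"
  assumes domain: "convex_domain \<Omega>" and bounded_domain: "bounded \<Omega>"
    and p: "1 < p" and c: "0 < c"
    and cont: "continuous_on (closure \<Omega>) u"
    and solution: "alexandrov_solution \<Omega> (\<lambda>x. c * (- u x) powr p) u"
    and boundary: "\<And>x. x \<in> frontier \<Omega> \<Longrightarrow> u x = 0"
    and nontrivial: "\<exists>x\<in>closure \<Omega>. u x \<noteq> 0"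
begin

lemma open_domain: "open \<Omega>" and convex_domain: "convex \<Omega>" and domain_nonempty: "\<Omega> \<noteq> {}"
  using domain by (auto simp: convex_domain_def)

sublocale conjugable \<Omega> u
  by standard (fact bounded_domain domain_nonempty cont)+

sublocale zero: conjugable \<Omega> "\<lambda>_. 0"
  by standard (simp_all add: bounded_domain domain_nonempty)

lemma convex_u: "convex_on \<Omega> u"
  using solution by (simp add: alexandrov_solution_def)

lemma closure_cases:
  assumes "x \<in> closure \<Omega>" obtains "x \<in> \<Omega>" | "x \<in> frontier \<Omega>"
  using assms open_domain by (auto simp: frontier_def interior_open)

text \<open>A positive maximum would be attained inside. At the point of the maximum set that is
  extreme in a direction \<open>e\<close>, convexity along a short segment parallel to
  \<open>e\<close> puts the endpoints into the maximum set as well, one of them beyond the extreme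
  point.\<close>

lemma nonpos:
  assumes x: "x \<in> closure \<Omega>"
  shows "u x \<le> 0"
proof (rule ccontr)
  assume "\<not> u x \<le> 0"
  have "closure \<Omega> \<noteq> {}" using domain_nonempty by simp
  from continuous_attains_sup[OF compact_closure_domain this cont]
  obtain m where m: "m \<in> closure \<Omega>" "\<And>z. z \<in> closure \<Omega> \<Longrightarrow> u z \<le> u m"
    by blast
  have pos: "0 < u m" using \<open>\<not> u x \<le> 0\<close> m(2)[OF x] by simp
  define K where "K = {z \<in> closure \<Omega>. u z = u m}"
  have "closed K"
    unfolding K_def using cont by (intro continuous_closed_preimage_constant) auto
  then have "compact K"
    using compact_Int_closed[OF compact_closure_domain, of K] by (simp add: K_def Int_absorb1 Collect_mono inf_absorb2 subset_iff)
  obtain e :: 'a where e: "e \<in> Basis" using nonempty_Basis by blast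
  have "continuous_on K (\<lambda>z. z \<bullet> e)" by (intro continuous_intros)
  moreover have "K \<noteq> {}" using m by (auto simp: K_def)
  ultimately obtain z where z: "z \<in> K" "\<And>v. v \<in> K \<Longrightarrow> v \<bullet> e \<le> z \<bullet> e"
    using continuous_attains_sup[OF \<open>compact K\<close>] by blast
  have "z \<in> closure \<Omega>" "u z \<noteq> 0"
    using z(1) pos by (auto simp: K_def)
  then have "z \<in> \<Omega>"
    using boundary closure_cases by blast
  then obtain r where r: "0 < r" "cball z r \<subseteq> \<Omega>"
    using open_domain open_contains_cball by blast
  have in\<Omega>: "z + r *\<^sub>R e \<in> \<Omega>" "z - r *\<^sub>R e \<in> \<Omega>"
    using r e by (auto intro!: subsetD[OF r(2)] simp: dist_norm)
  have "u ((1 - 1/2) *\<^sub>R (z + r *\<^sub>R e) + (1/2) *\<^sub>R (z - r *\<^sub>R e))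
      \<le> (1 - 1/2) * u (z + r *\<^sub>R e) + 1/2 * u (z - r *\<^sub>R e)"
    using in\<Omega> by (intro convex_onD[OF convex_u]) auto
  moreover have "(1 - 1/2) *\<^sub>R (z + r *\<^sub>R e) + (1/2) *\<^sub>R (z - r *\<^sub>R e) = z"
    by (simp add: algebra_simps flip: scaleR_add_left)
  moreover have "u (z + r *\<^sub>R e) \<le> u m" "u (z - r *\<^sub>R e) \<le> u m"
    using in\<Omega> m(2) closure_subset by auto
  ultimately have "u (z + r *\<^sub>R e) = u m"
    using z(1) by (simp add: K_def)
  then have "(z + r *\<^sub>R e) \<bullet> e \<le> z \<bullet> e"
    using in\<Omega> closure_subset by (intro z(2)) (auto simp: K_def)
  then show False using r e by (simp add: inner_add_left)
qed

text \<open>Prolonging the segment from a point \<open>v\<close> with \<open>u v < 0\<close> through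
  \<open>x\<close> slightly beyond \<open>x\<close> makes \<open>x\<close> a proper convex
  combination of \<open>v\<close> and a point where \<open>u\<close> is at most 0.\<close>

lemma negative:
  assumes x: "x \<in> \<Omega>"
  shows "u x < 0"
proof (rule ccontr)
  assume "\<not> u x < 0"
  then have ux: "u x = 0" using nonpos[of x] x closure_subset by force
  obtain v where v: "v \<in> closure \<Omega>" "u v \<noteq> 0" using nontrivial by blast
  then have v\<Omega>: "v \<in> \<Omega>" and neg: "u v < 0"
    using boundary nonpos[of v] by (auto elim: closure_cases)
  obtain r where r: "0 < r" "cball x r \<subseteq> \<Omega>"
    using x open_domain open_contains_cball by blast
  \<comment> \<open>The weight with \<open>x = (1 - s) *\<^sub>R z + s *\<^sub>R v\<close>, where
    \<open>z\<close> lies at distance \<open>r\<close> beyond \<open>x\<close>.\<close>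
  define s where "s = r / (r + norm (x - v))"
  have nv: "0 < norm (x - v)" using ux neg by auto
  then have s: "0 < s" "s < 1"
    unfolding s_def using r by (auto intro!: divide_pos_pos add_pos_pos simp del: zero_less_norm_iff)
  define z where "z = x + (r / norm (x - v)) *\<^sub>R (x - v)"
  have "z \<in> cball x r" using nv r by (simp add: z_def dist_norm)
  then have z: "z \<in> \<Omega>" using r by blast
  have "(1 - s) *\<^sub>R z + s *\<^sub>R v = x + ((1 - s) * (r / norm (x - v)) - s) *\<^sub>R (x - v)"
    by (simp add: z_def algebra_simps)
  also have "(1 - s) * (r / norm (x - v)) - s = 0"
  proof -
    have "1 - s = norm (x - v) / (r + norm (x - v))"
    proof -
      have "r + norm (x - v) \<noteq> 0" using nv r by linarith
      then show ?thesis unfolding s_def by (simp add: field_simps)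
    qed
    then show ?thesis using nv by (simp add: s_def)
  qed
  finally have "u x \<le> (1 - s) * u z + s * u v"
    using convex_onD[OF convex_u, of s z v] s z v\<Omega> by simp
  moreover have "(1 - s) * u z \<le> 0" "s * u v < 0"
    using s neg nonpos[of z] z closure_subset by (auto intro!: mult_nonneg_nonpos mult_pos_neg)
  ultimately show False using ux by simp
qed

lemma monge_ampere_eq:
  assumes "E \<in> sets borel" "E \<subseteq> \<Omega>"
  shows "emeasure lebesgue (subdifferential_image \<Omega> u E)
      = (\<integral>\<^sup>+x\<in>E. ennreal (c * (- u x) powr p) \<partial>lborel)"
  using solution assms unfolding alexandrov_solution_def monge_ampere_def by blast

lemma density_borel: "(\<lambda>x. indicator \<Omega> x * (- u x) powr q) \<in> borel_measurable borel"
proof -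
  have "continuous_on \<Omega> (\<lambda>x. (- u x) powr q)"
    using negative by (intro continuous_intros continuous_on_subset[OF cont closure_subset]) force
  then show ?thesis
    using borel_measurable_continuous_on_indicator[of \<Omega> "\<lambda>x. (- u x) powr q"] open_domain by simp
qed

lemma density_indicator:
  "E \<subseteq> \<Omega> \<Longrightarrow> ennreal (c * (- u x) powr p) * indicator E x
      = ennreal (c * (indicator \<Omega> x * (- u x) powr p)) * indicator E x"
  by (auto simp: indicator_def)

text \<open>The density is strictly positive inside. This is also the source of subgradients below:
  every nonempty open subset of the domain contains a point that has one.\<close>

lemma subdifferential_image_pos:
  assumes "open E" "E \<subseteq> \<Omega>" "E \<noteq> {}"
  shows "0 < emeasure lebesgue (subdifferential_image \<Omega> u E)"
proof (rule ccontr)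
  assume "\<not> ?thesis"
  then have "(\<integral>\<^sup>+x\<in>E. ennreal (c * (- u x) powr p) \<partial>lborel) = 0"
    using monge_ampere_eq[of E] assms by auto
  then have "AE x in lborel. ennreal (c * (indicator \<Omega> x * (- u x) powr p)) * indicator E x = 0"
    using density_borel[of p] assms by (subst nn_integral_0_iff_AE[symmetric]) (auto simp: density_indicator)
  then have "AE x in lborel. x \<notin> E"
  proof eventually_elim
    case (elim x)
    show ?case
    proof
      assume x: "x \<in> E"
      then have "0 < c * (- u x) powr p"
        using negative[of x] c assms(2) by (intro mult_pos_pos) auto
      then show False
        using elim x assms(2) by (auto simp: indicator_def ennreal_eq_0_iff)
    qed
  qed
  then have "E \<in> null_sets lborel"
    using assms by (intro AE_iff_null_sets[THEN iffD2]) auto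
  then show False using assms open_not_negligible[of E] by (simp add: negligible_iff_null_sets null_sets_completionI)
qed

text \<open>A set outside \<open>sets lebesgue\<close> has \<open>emeasure\<close> 0, so positivity already implies measurability.\<close>

lemma subdifferential_image_measurable:
  assumes "open E" "E \<subseteq> \<Omega>"
  shows "subdifferential_image \<Omega> u E \<in> sets lebesgue"
proof (cases "E = {}")
  case True
  then show ?thesis by (simp add: subdifferential_image_def)
next
  case False
  then show ?thesis
    using subdifferential_image_pos[OF assms] emeasure_notin_sets by fastforce
qed

definition depth :: real where "depth = (SOME m. 0 < m \<and> (\<forall>x\<in>closure \<Omega>. - u x \<le> m))"

lemma depth: "0 < depth" "x \<in> closure \<Omega> \<Longrightarrow> - u x \<le> depth"
proof -
  obtain m where "\<And>x. x \<in> closure \<Omega> \<Longrightarrow> norm (u x) \<le> m"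
    using compact_imp_bounded[OF compact_continuous_image[OF cont compact_closure_domain]]
    unfolding bounded_iff by auto
  then have "0 < max 1 m \<and> (\<forall>x\<in>closure \<Omega>. - u x \<le> max 1 m)"
    by (auto intro!: order_trans[OF _ max.cobounded2] simp: abs_le_iff)
  then have "0 < depth \<and> (\<forall>x\<in>closure \<Omega>. - u x \<le> depth)"
    unfolding depth_def by (rule someI)
  then show "0 < depth" "x \<in> closure \<Omega> \<Longrightarrow> - u x \<le> depth" by auto
qed

lemma subdifferential_image_finite: "emeasure lebesgue (subdifferential_image \<Omega> u \<Omega>) < \<infinity>"
proof -
  have "emeasure lebesgue (subdifferential_image \<Omega> u \<Omega>) \<le> (\<integral>\<^sup>+x\<in>\<Omega>. ennreal (c * depth powr p) \<partial>lborel)"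
    unfolding monge_ampere_eq[OF borel_open[OF open_domain] order_refl]
    using c p depth negative closure_subset
    by (intro nn_integral_mono) (auto simp: indicator_def less_imp_le intro!: ennreal_leI mult_left_mono powr_mono2)
  also have "\<dots> = ennreal (c * depth powr p) * emeasure lborel \<Omega>"
    using open_domain by (simp add: nn_integral_cmult_indicator)
  also have "\<dots> < \<infinity>"
    using emeasure_bounded_finite[OF bounded_domain] by (simp add: ennreal_mult_less_top)
  finally show ?thesis .
qed

lemma gap_nonneg: "0 \<le> conjugate_gap \<Omega> u y"
proof -
  have "conjugate \<Omega> (\<lambda>_. 0) y \<le> conjugate \<Omega> u y"
  proof (rule zero.conjugate_le)
    fix x assume "x \<in> closure \<Omega>"
    then show "x \<bullet> y - 0 \<le> conjugate \<Omega> u y"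
      using conjugate_ge[of x y] nonpos[of x] by simp
  qed
  then show ?thesis by (simp add: conjugate_gap_def)
qed

lemma gap_le: "conjugate_gap \<Omega> u y \<le> depth"
proof -
  have "conjugate \<Omega> u y \<le> conjugate \<Omega> (\<lambda>_. 0) y + depth"
  proof (rule conjugate_le)
    fix x assume "x \<in> closure \<Omega>"
    then show "x \<bullet> y - u x \<le> conjugate \<Omega> (\<lambda>_. 0) y + depth"
      using zero.conjugate_ge[of x y] depth(2)[of x] by simp
  qed
  then show ?thesis by (simp add: conjugate_gap_def)
qed

text \<open>A slope not attained inside has its maximiser on the boundary, where \<open>u\<close>
  and 0 agree.\<close>

lemma gap_eq_0:
  assumes "y \<notin> subdifferential_image \<Omega> u \<Omega>"
  shows "conjugate_gap \<Omega> u y = 0"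
proof -
  obtain x where x: "x \<in> closure \<Omega>" "conjugate \<Omega> u y = x \<bullet> y - u x"
    by (rule conjugate_attained)
  then have "x \<notin> \<Omega>"
    using assms subdifferential_of_attained by (auto simp: subdifferential_image_def)
  then have "u x = 0" using x boundary by (auto elim: closure_cases)
  then have "conjugate \<Omega> u y \<le> conjugate \<Omega> (\<lambda>_. 0) y"
    using x zero.conjugate_ge[OF x(1), of y] by simp
  then show ?thesis using gap_nonneg[of y] by (simp add: conjugate_gap_def)
qed

lemma gap_continuous: "continuous_on UNIV (conjugate_gap \<Omega> u)"
  unfolding conjugate_gap_def by (intro continuous_intros conjugate_continuous zero.conjugate_continuous)

lemma gap_borel [measurable]: "conjugate_gap \<Omega> u \<in> borel_measurable borel"
  by (rule borel_measurable_continuous_onI[OF gap_continuous])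

lemma gap_integrable: "integrable lborel (conjugate_gap \<Omega> u)"
proof (rule Bochner_Integration.integrable_bound)
  let ?N = "{y. conjugate_gap \<Omega> u y \<noteq> 0}"
  have "emeasure lborel ?N = emeasure lebesgue ?N" by simp
  also have "\<dots> \<le> emeasure lebesgue (subdifferential_image \<Omega> u \<Omega>)"
    using gap_eq_0 subdifferential_image_measurable[OF open_domain]
    by (intro emeasure_mono) auto
  finally have "emeasure lborel ?N < \<infinity>"
    using subdifferential_image_finite by (rule order.strict_trans1)
  then show "integrable lborel (\<lambda>y. depth * indicator ?N y :: real)"
    by (intro integrable_mult_right integrable_real_indicator) auto
  show "AE y in lborel. norm (conjugate_gap \<Omega> u y) \<le> norm (depth * indicator ?N y :: real)"
    using gap_nonneg gap_le depth by (intro AE_I2) (auto simp: indicator_def)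
qed simp

text \<open>At slope 0 the gap is the maximum of \<open>- u\<close>, which is positive, and
  continuity spreads this to an open set.\<close>

lemma conjugate_volume_pos: "0 < conjugate_volume \<Omega> u"
proof -
  have "0 \<le> conjugate_volume \<Omega> u"
    unfolding conjugate_volume_def using gap_nonneg by simp
  moreover have "conjugate_volume \<Omega> u \<noteq> 0"
  proof
    assume "conjugate_volume \<Omega> u = 0"
    then have ae: "AE y in lborel. conjugate_gap \<Omega> u y = 0"
      unfolding conjugate_volume_def
      using integral_nonneg_eq_0_iff_AE[OF gap_integrable] gap_nonneg by auto
    obtain x where x: "x \<in> \<Omega>" using domain_nonempty by blast
    have "x \<in> closure \<Omega>" using x closure_subset by blast
    from conjugate_ge[OF this, of 0] have "0 < conjugate \<Omega> u 0"
      using negative[OF x] by simp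
    moreover have "conjugate \<Omega> (\<lambda>_. 0) (0 :: 'a) = 0"
      by (rule zero.conjugate_attained[of 0]) simp
    ultimately have "0 < conjugate_gap \<Omega> u 0"
      by (simp add: conjugate_gap_def)
    moreover have "open {y. 0 < conjugate_gap \<Omega> u y}"
      using gap_continuous by (intro open_Collect_less) auto
    ultimately have "\<not> negligible {y. 0 < conjugate_gap \<Omega> u y}"
      by (intro open_not_negligible) auto
    moreover have "{y. 0 < conjugate_gap \<Omega> u y} \<in> null_sets lborel"
      using ae by (intro AE_iff_null_sets[THEN iffD2]) (auto elim: eventually_mono)
    ultimately show False by (simp add: negligible_iff_null_sets null_sets_completionI)
  qed
  ultimately show ?thesis by simp
qed

end

section \<open>Dilation of solutions\<close>

lemma integral_lborel_scaleR:
  fixes f :: "'a::euclidean_space \<Rightarrow> real"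
  assumes "0 < r" and f [measurable]: "f \<in> borel_measurable borel"
  shows "(\<integral>x. f (x /\<^sub>R r) \<partial>lborel) = r ^ DIM('a) * integral\<^sup>L lborel f"
proof -
  have "(\<integral>x. f (x /\<^sub>R r) \<partial>lborel)
      = (\<integral>x. f (x /\<^sub>R r) \<partial>density (distr lborel borel (\<lambda>x :: 'a. 0 + r *\<^sub>R x)) (\<lambda>_. ennreal (\<bar>r\<bar> ^ DIM('a))))"
    using lborel_affine[of r "0 :: 'a"] assms(1) by simp
  also have "\<dots> = (\<integral>x. \<bar>r\<bar> ^ DIM('a) *\<^sub>R f ((0 + r *\<^sub>R x) /\<^sub>R r) \<partial>lborel)"
    by (subst integral_density) (auto simp: integral_distr)
  finally show ?thesis using assms(1) by simp
qed

lemma subdifferential_scale: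
  assumes "0 < r"
  shows "subdifferential \<Omega> (\<lambda>x. r * u x) x = (*\<^sub>R) r ` subdifferential \<Omega> u x"
proof (intro equalityI subsetI)
  fix y assume y: "y \<in> subdifferential \<Omega> (\<lambda>x. r * u x) x"
  have "y /\<^sub>R r \<in> subdifferential \<Omega> u x"
    unfolding subdifferential_def
  proof safe
    fix z assume "z \<in> \<Omega>"
    then have "r * u x + y \<bullet> (z - x) \<le> r * u z"
      using y by (simp add: subdifferential_def)
    then have "inverse r * (r * u x + y \<bullet> (z - x)) \<le> inverse r * (r * u z)"
      using assms by (intro mult_left_mono) auto
    then show "u x + (y /\<^sub>R r) \<bullet> (z - x) \<le> u z"
      using assms by (simp add: distrib_left flip: mult.assoc)
  qed
  then show "y \<in> (*\<^sub>R) r ` subdifferential \<Omega> u x"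
    using assms by (intro image_eqI[of _ _ "y /\<^sub>R r"]) auto
next
  fix y assume "y \<in> (*\<^sub>R) r ` subdifferential \<Omega> u x"
  then obtain y' where y': "y = r *\<^sub>R y'" "y' \<in> subdifferential \<Omega> u x" by blast
  show "y \<in> subdifferential \<Omega> (\<lambda>x. r * u x) x"
    unfolding subdifferential_def
  proof safe
    fix z assume "z \<in> \<Omega>"
    then have "u x + y' \<bullet> (z - x) \<le> u z"
      using y' by (simp add: subdifferential_def)
    then have "r * (u x + y' \<bullet> (z - x)) \<le> r * u z"
      using assms by (intro mult_left_mono) auto
    then show "r * u x + y \<bullet> (z - x) \<le> r * u z"
      using y' by (simp add: distrib_left)
  qed
qed

lemma (in conjugable) conjugate_scale:
  assumes "0 < r"
  shows "conjugate \<Omega> (\<lambda>x. r * u x) y = r * conjugate \<Omega> u (y /\<^sub>R r)"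
proof (rule antisym)
  interpret S: conjugable \<Omega> "\<lambda>x. r * u x"
    by standard (use bounded_domain nonempty in \<open>auto intro!: continuous_intros cont\<close>)
  have eq: "x \<bullet> y - r * u x = r * (x \<bullet> (y /\<^sub>R r) - u x)" for x
    using assms by (simp add: right_diff_distrib)
  show "conjugate \<Omega> (\<lambda>x. r * u x) y \<le> r * conjugate \<Omega> u (y /\<^sub>R r)"
    unfolding eq[symmetric]
  proof (rule S.conjugate_le)
    fix x assume "x \<in> closure \<Omega>"
    then show "x \<bullet> y - r * u x \<le> r * conjugate \<Omega> u (y /\<^sub>R r)"
      unfolding eq using assms conjugate_ge[of x "y /\<^sub>R r"] by (intro mult_left_mono) auto
  qed
  obtain x where "x \<in> closure \<Omega>" "conjugate \<Omega> u (y /\<^sub>R r) = x \<bullet> (y /\<^sub>R r) - u x"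
    by (rule conjugate_attained)
  then show "r * conjugate \<Omega> u (y /\<^sub>R r) \<le> conjugate \<Omega> (\<lambda>x. r * u x) y"
    using S.conjugate_ge[of x y] eq[of x] by simp
qed

context power_solution
begin

text \<open>With n the dimension, the subdifferential image is dilated by \<open>r\<close>, which
  gives r^n, while the p-th power of the function gains r^p; the new factor absorbs the
  quotient.\<close>

lemma power_solution_scale:
  assumes r: "0 < r"
  shows "power_solution \<Omega> p (c * (r ^ DIM('a) * r powr (- p))) (\<lambda>x. r * u x)"
proof
  show "convex_domain \<Omega>" "bounded \<Omega>" "1 < p" by (fact domain bounded_domain p)+
  show "0 < c * (r ^ DIM('a) * r powr (- p))" using r c by simp
  show "continuous_on (closure \<Omega>) (\<lambda>x. r * u x)" by (intro continuous_intros cont)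
  show "r * u x = 0" if "x \<in> frontier \<Omega>" for x using boundary[OF that] by simp
  show "\<exists>x\<in>closure \<Omega>. r * u x \<noteq> 0" using nontrivial r by auto
  show "alexandrov_solution \<Omega> (\<lambda>x. c * (r ^ DIM('a) * r powr (- p)) * (- (r * u x)) powr p) (\<lambda>x. r * u x)"
    unfolding alexandrov_solution_def
  proof (intro conjI allI impI)
    show "convex_on \<Omega> (\<lambda>x. r * u x)"
      using convex_on_cmul[OF _ convex_u, of r] r by simp
    fix E :: "'a set" assume E: "E \<in> sets borel \<and> E \<subseteq> \<Omega>"
    have "subdifferential_image \<Omega> (\<lambda>x. r * u x) E = (\<lambda>y. r *\<^sub>R y + 0) ` subdifferential_image \<Omega> u E"
      by (auto simp: subdifferential_image_def subdifferential_scale[OF r])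
    then have "monge_ampere \<Omega> (\<lambda>x. r * u x) E = ennreal (r ^ DIM('a)) * (\<integral>\<^sup>+x\<in>E. ennreal (c * (- u x) powr p) \<partial>lborel)"
      unfolding monge_ampere_def using E r
      by (simp only: emeasure_lebesgue_affine monge_ampere_eq) (simp add: ennreal_power)
    also have "\<dots> = (\<integral>\<^sup>+x. ennreal (r ^ DIM('a)) * (ennreal (c * (indicator \<Omega> x * (- u x) powr p)) * indicator E x) \<partial>lborel)"
      using E density_borel[of p] density_indicator[of E]
      by (subst nn_integral_cmult) auto
    also have "\<dots> = (\<integral>\<^sup>+x\<in>E. ennreal (c * (r ^ DIM('a) * r powr (- p)) * (- (r * u x)) powr p) \<partial>lborel)"
    proof (rule nn_integral_cong)
      fix x :: 'a
      show "ennreal (r ^ DIM('a)) * (ennreal (c * (indicator \<Omega> x * (- u x) powr p)) * indicator E x)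
          = ennreal (c * (r ^ DIM('a) * r powr (- p)) * (- (r * u x)) powr p) * indicator E x"
      proof (cases "x \<in> E")
        case True
        then have x: "x \<in> \<Omega>" using E by blast
        have "(- (r * u x)) powr p = r powr p * (- u x) powr p"
          using r negative[OF x] powr_mult[of r "- u x" p] by simp
        then have "c * (r ^ DIM('a) * r powr (- p)) * (- (r * u x)) powr p
            = r ^ DIM('a) * (c * (- u x) powr p) * (r powr (- p) * r powr p)"
          by simp
        also have "r powr (- p) * r powr p = 1"
          using r by (simp flip: powr_add)
        finally have e: "c * (r ^ DIM('a) * r powr (- p)) * (- (r * u x)) powr p
            = r ^ DIM('a) * (c * (- u x) powr p)"
          by simp
        show ?thesis unfolding e using True x r by (simp add: ennreal_mult')
      qed simp
    qed
    finally show "monge_ampere \<Omega> (\<lambda>x. r * u x) E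
        = (\<integral>\<^sup>+x\<in>E. ennreal (c * (r ^ DIM('a) * r powr (- p)) * (- (r * u x)) powr p) \<partial>lborel)" .
  qed
qed

text \<open>One power of \<open>r\<close> comes from the values of the gap, the others from the
  dilation of the slopes.\<close>

lemma conjugate_volume_scale:
  assumes r: "0 < r"
  shows "conjugate_volume \<Omega> (\<lambda>x. r * u x) = r ^ Suc DIM('a) * conjugate_volume \<Omega> u"
proof -
  have "conjugate_gap \<Omega> (\<lambda>x. r * u x) y = r * conjugate_gap \<Omega> u (y /\<^sub>R r)" for y
    using conjugate_scale[OF r, of y] zero.conjugate_scale[OF r, of y]
    by (simp add: conjugate_gap_def right_diff_distrib)
  then have "conjugate_volume \<Omega> (\<lambda>x. r * u x) = r * (\<integral>y. conjugate_gap \<Omega> u (y /\<^sub>R r) \<partial>lborel)"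
    by (simp add: conjugate_volume_def)
  then show ?thesis
    by (simp only: integral_lborel_scaleR[OF r gap_borel]) (simp add: conjugate_volume_def)
qed

end

text \<open>Applied to the perspectives \<open>r * conjugate (y / r)\<close>, whose subgradient at \<open>r\<close> is the contact height.\<close>

lemma eq_of_common_subgradient:
  fixes f g m :: "real \<Rightarrow> real"
  assumes f: "\<And>x y. 0 < x \<Longrightarrow> 0 < y \<Longrightarrow> f x + m x * (y - x) \<le> f y"
    and g: "\<And>x y. 0 < x \<Longrightarrow> 0 < y \<Longrightarrow> g x + m x * (y - x) \<le> g y"
    and m: "\<And>x. 0 < x \<Longrightarrow> 0 \<le> m x" "m 1 \<le> B"
    and lim: "\<And>x. 0 < x \<Longrightarrow> \<bar>f x - g x\<bar> \<le> x * D"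
  shows "f 1 = g 1"
proof (rule ccontr)
  assume ne: "f 1 \<noteq> g 1"
  define k where "k x = f x - g x" for x
  \<comment> \<open>The increments of \<open>f\<close> and of \<open>g\<close> from \<open>x\<close>
    to \<open>y\<close> both lie between \<open>m x * (y - x)\<close> and
    \<open>m y * (y - x)\<close>, so they differ by at most the length of that interval.\<close>
  have step: "\<bar>k y - k x\<bar> \<le> (m y - m x) * (y - x)" if "0 < x" "0 < y" for x y
    using f[OF that] g[OF that] f[OF that(2,1)] g[OF that(2,1)]
    by (simp add: k_def algebra_simps abs_le_iff)
  have bound: "\<bar>k 1\<bar> * real N \<le> B + D" if N: "0 < N" for N :: nat
  proof -
    \<comment> \<open>With equal steps \<open>1 / N\<close> the increments of \<open>m\<close>
      telescope, so the total change of \<open>k\<close> on the interval from \<open>1 / N\<close>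
      to 1 is O(1/N). The value at \<open>1 / N\<close> is O(1/N) by \<open>lim\<close>.\<close>
    have "\<bar>k (real (Suc i) / N) - k (1 / N)\<bar> \<le> (m (real (Suc i) / N) - m (1 / N)) * (1 / N)" for i
    proof (induction i)
      case (Suc i)
      have "\<bar>k (real (Suc (Suc i)) / N) - k (real (Suc i) / N)\<bar>
          \<le> (m (real (Suc (Suc i)) / N) - m (real (Suc i) / N)) * (real (Suc (Suc i)) / N - real (Suc i) / N)"
        using N by (intro step) auto
      also have "real (Suc (Suc i)) / N - real (Suc i) / N = 1 / N"
        by (simp flip: diff_divide_distrib)
      finally show ?case using Suc unfolding left_diff_distrib by linarith
    qed simp
    from this[of "N - 1"] have "\<bar>k 1 - k (1 / N)\<bar> \<le> (m 1 - m (1 / N)) * (1 / N)"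
      using N by simp
    also have "\<dots> \<le> B * (1 / N)"
      using m(1)[of "1 / N"] m(2) N by (intro mult_right_mono) auto
    finally have "\<bar>k 1\<bar> \<le> B * (1 / N) + (1 / N) * D"
      using lim[of "1 / N"] N by (simp add: k_def)
    also have "\<dots> = (B + D) / N" by (simp add: add_divide_distrib)
    finally show ?thesis using N by (simp add: pos_le_divide_eq)
  qed
  have "0 < \<bar>k 1\<bar>" using ne by (simp add: k_def)
  then obtain N :: nat where "B + D < real N * \<bar>k 1\<bar>"
    using ex_less_of_nat_mult by blast
  moreover have "\<bar>k 1\<bar> * real (Suc N) \<le> B + D" by (rule bound) simp
  ultimately show False using \<open>0 < \<bar>k 1\<bar>\<close> by (simp add: algebra_simps)
qed

text \<open>Two applications of the mean value theorem. The intermediate points stay in the interval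
  from 0 to \<open>K\<close>, where \<open>p > 1\<close> bounds the remaining power by
  \<open>K powr (p - 1)\<close>. The factor 1/2 of the exact Taylor remainder is given up.\<close>

lemma powr_taylor_upper:
  fixes x a K p :: real
  assumes x: "0 < x" "x \<le> K" and a: "0 < a" "a \<le> K" and p: "1 < p"
  shows "x powr (p + 1) \<le> a powr (p + 1) + (p + 1) * a powr p * (x - a)
      + (p + 1) * p * K powr (p - 1) * (x - a)\<^sup>2"
proof -
  have deriv: "((\<lambda>z. z powr r) has_real_derivative r * z powr (r - 1)) (at z)" if "0 < z" for r z :: real
    using that by (rule has_real_derivative_powr)
  have mvt: "\<exists>\<xi>>0. \<xi> \<le> K \<and> \<bar>\<xi> - a\<bar> \<le> \<bar>y - a\<bar> \<and> y powr r - a powr r = r * \<xi> powr (r - 1) * (y - a)"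
    if y: "0 < y" "y \<le> K" for y r :: real
  proof (cases y a rule: linorder_cases)
    case less
    then obtain z where "y < z" "z < a" "a powr r - y powr r = (a - y) * (r * z powr (r - 1))"
      using MVT2[OF less deriv] y by (metis order_less_le_trans)
    then show ?thesis using y a less
      by (intro exI[of _ z]) (auto simp: algebra_simps)
  next
    case equal
    then show ?thesis using a by (intro exI[of _ a]) auto
  next
    case greater
    then obtain z where "a < z" "z < y" "y powr r - a powr r = (y - a) * (r * z powr (r - 1))"
      using MVT2[OF greater deriv] a by (metis order_less_le_trans)
    then show ?thesis using y a greater
      by (intro exI[of _ z]) (auto simp: algebra_simps)
  qed
  obtain \<xi> where \<xi>: "0 < \<xi>" "\<xi> \<le> K" "\<bar>\<xi> - a\<bar> \<le> \<bar>x - a\<bar>"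
    "x powr (p + 1) - a powr (p + 1) = (p + 1) * \<xi> powr p * (x - a)"
    using mvt[OF x, of "p + 1"] by auto
  obtain \<eta> where \<eta>: "0 < \<eta>" "\<eta> \<le> K" "\<xi> powr p - a powr p = p * \<eta> powr (p - 1) * (\<xi> - a)"
    using mvt[OF \<xi>(1,2), of p] by auto
  have "\<bar>\<xi> powr p - a powr p\<bar> \<le> p * K powr (p - 1) * \<bar>x - a\<bar>"
    unfolding \<eta>(3) abs_mult using \<xi>(3) \<eta> p
    by (intro mult_mono) (auto intro!: powr_mono2)
  then have "\<bar>\<xi> powr p - a powr p\<bar> * \<bar>x - a\<bar> \<le> p * K powr (p - 1) * \<bar>x - a\<bar> * \<bar>x - a\<bar>"
    by (rule mult_right_mono) simp
  then have "(\<xi> powr p - a powr p) * (x - a) \<le> p * K powr (p - 1) * (x - a)\<^sup>2"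
    by (simp add: power2_eq_square mult.assoc flip: abs_mult)
  then have "(p + 1) * ((\<xi> powr p - a powr p) * (x - a)) \<le> (p + 1) * (p * K powr (p - 1) * (x - a)\<^sup>2)"
    using p by (intro mult_left_mono) auto
  then show ?thesis using \<xi>(4) by (simp add: algebra_simps)
qed

section \<open>Interpolating conjugates\<close>

text \<open>The layer cake formula is applied on the side of slopes, where the sets are only
  Lebesgue measurable.\<close>

lemma sigma_finite_lebesgue: "sigma_finite_measure (lebesgue :: 'a::euclidean_space measure)"
proof -
  obtain A :: "'a set set" where A: "countable A" "A \<subseteq> sets lborel" "\<Union>A = space lborel"
    "\<forall>a\<in>A. emeasure lborel a \<noteq> \<infinity>"
    using lborel.sigma_finite_countable by blast
  show ?thesis
  proof
    have "emeasure lebesgue a \<noteq> \<infinity>" if "a \<in> A" for a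
      using A that by auto
    then show "\<exists>A :: 'a set set. countable A \<and> A \<subseteq> sets lebesgue \<and> \<Union>A = space lebesgue \<and> (\<forall>a\<in>A. emeasure lebesgue a \<noteq> \<infinity>)"
      using A by (intro exI[of _ A]) auto
  qed
qed

text \<open>Exponent \<open>p + 1\<close> gives the functional compared along the path; exponent
  \<open>p\<close> gives the total Monge-Ampere mass up to the factor \<open>c\<close>.\<close>

definition power_mass :: "'a::euclidean_space set \<Rightarrow> real \<Rightarrow> ('a \<Rightarrow> real) \<Rightarrow> real" where
  "power_mass \<Omega> q f = (\<integral>x. indicator \<Omega> x * f x powr q \<partial>lborel)"

context power_solution
begin

lemma borel_domain:
  assumes "continuous_on \<Omega> k"
  shows "(\<lambda>x. indicator \<Omega> x * (k x :: real)) \<in> borel_measurable borel"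
  using borel_measurable_continuous_on_indicator[OF _ assms] open_domain by simp

lemma integrable_domain_bounded:
  fixes k :: "'a \<Rightarrow> real"
  assumes "(\<lambda>x. indicator \<Omega> x * k x) \<in> borel_measurable borel" and le: "\<And>x. x \<in> \<Omega> \<Longrightarrow> \<bar>k x\<bar> \<le> C"
  shows "integrable lborel (\<lambda>x. indicator \<Omega> x * k x)"
proof (rule Bochner_Integration.integrable_bound)
  show "integrable lborel (\<lambda>x. C * indicator \<Omega> x :: real)"
    using open_domain emeasure_bounded_finite[OF bounded_domain]
    by (intro integrable_mult_right integrable_real_indicator) auto
  show "AE x in lborel. norm (indicator \<Omega> x * k x) \<le> norm (C * indicator \<Omega> x :: real)"
  proof (rule AE_I2)
    fix x show "norm (indicator \<Omega> x * k x) \<le> norm (C * indicator \<Omega> x :: real)"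
      using le[of x] by (cases "x \<in> \<Omega>") auto
  qed
qed (use assms(1) in simp)

lemma open_Collect_less_domain:
  fixes f g :: "'a \<Rightarrow> real"
  assumes "continuous_on \<Omega> f" "continuous_on \<Omega> g"
  shows "open {x \<in> \<Omega>. f x < g x}"
proof -
  have "open (\<Omega> \<inter> (\<lambda>x. g x - f x) -` {0<..})"
    using assms open_domain by (intro continuous_open_preimage continuous_intros) auto
  moreover have "\<Omega> \<inter> (\<lambda>x. g x - f x) -` {0<..} = {x \<in> \<Omega>. f x < g x}" by auto
  ultimately show ?thesis by simp
qed

lemmas integrable_domain = integrable_domain_bounded[OF borel_domain]

lemma continuous_domain: "continuous_on \<Omega> u"
  by (rule continuous_on_subset[OF cont closure_subset])

lemma in_closure: "x \<in> \<Omega> \<Longrightarrow> x \<in> closure \<Omega>"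
  using closure_subset by blast

lemma bounds: "x \<in> \<Omega> \<Longrightarrow> 0 < - u x" "x \<in> \<Omega> \<Longrightarrow> - u x \<le> depth"
  using negative depth(2) in_closure by auto

lemma integrable_power: "0 \<le> q \<Longrightarrow> integrable lborel (\<lambda>x. indicator \<Omega> x * (- u x) powr q)"
proof (rule integrable_domain)
  show "continuous_on \<Omega> (\<lambda>x. (- u x) powr q)"
    using negative by (intro continuous_intros continuous_domain) force
  show "\<bar>(- u x) powr q\<bar> \<le> depth powr q" if "0 \<le> q" "x \<in> \<Omega>" for x
    using bounds[OF that(2)] that(1) by (auto intro: powr_mono2)
qed

lemma power_mass_pos:
  assumes "0 \<le> q"
  shows "0 < power_mass \<Omega> q (\<lambda>x. - u x)"
proof -
  have "0 \<le> power_mass \<Omega> q (\<lambda>x. - u x)"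
    unfolding power_mass_def by (intro Bochner_Integration.integral_nonneg) auto
  moreover have "power_mass \<Omega> q (\<lambda>x. - u x) \<noteq> 0"
  proof
    assume "power_mass \<Omega> q (\<lambda>x. - u x) = 0"
    then have "AE x in lborel. indicator \<Omega> x * (- u x) powr q = 0"
      unfolding power_mass_def
      using integral_nonneg_eq_0_iff_AE[OF integrable_power[OF assms]] by simp
    then have "AE x in lborel. x \<notin> \<Omega>"
      by eventually_elim (use negative in \<open>force simp: indicator_def split: if_splits\<close>)
    then have "\<Omega> \<in> null_sets lborel"
      using open_domain by (intro AE_iff_null_sets[THEN iffD2]) auto
    then show False
      using open_not_negligible[OF open_domain domain_nonempty]
      by (simp add: negligible_iff_null_sets null_sets_completionI)
  qed
  ultimately show ?thesis by simp
qed

lemma total_measure: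
  "emeasure lebesgue (subdifferential_image \<Omega> u \<Omega>) = ennreal (c * power_mass \<Omega> p (\<lambda>x. - u x))"
proof -
  have "emeasure lebesgue (subdifferential_image \<Omega> u \<Omega>)
      = (\<integral>\<^sup>+x. ennreal (c * (indicator \<Omega> x * (- u x) powr p)) \<partial>lborel)"
    using monge_ampere_eq[of \<Omega>] open_domain
    by (auto intro!: nn_integral_cong simp: indicator_def)
  also have "\<dots> = ennreal (\<integral>x. c * (indicator \<Omega> x * (- u x) powr p) \<partial>lborel)"
    using c p integrable_power[of p] by (intro nn_integral_eq_integral) auto
  finally show ?thesis by (simp add: power_mass_def)
qed

end

section \<open>The path between two solutions of equal conjugate volume\<close>

locale solution_pair =
  U: power_solution \<Omega> p c0 u + W: power_solution \<Omega> p c1 w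
  for \<Omega> :: "'a::euclidean_space set" and p c0 c1 :: real and u w :: "'a \<Rightarrow> real" +
  assumes volume_eq: "conjugate_volume \<Omega> u = conjugate_volume \<Omega> w"
begin

text \<open>Turns one-sided statements such as \<open>mass_w_le\<close> and
  \<open>le_solution\<close> into equalities.\<close>

lemma swap: "solution_pair \<Omega> p c1 c0 w u"
  by unfold_locales (simp add: volume_eq)

text \<open>The value \<open>- interp s\<close> is the Legendre transform of the linear interpolation of the two conjugates,
  that is, the infimal convolution of \<open>u\<close> and \<open>w\<close> with weights \<open>1 - s\<close> and \<open>s\<close>.\<close>

definition interp :: "real \<Rightarrow> 'a \<Rightarrow> real" where
  "interp s z = (INF y. (1 - s) * conjugate \<Omega> u y + s * conjugate \<Omega> w y - z \<bullet> y)"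

lemma interp_ge_raw:
  assumes "0 \<le> s" "s \<le> 1" "x \<in> closure \<Omega>" "z \<in> closure \<Omega>"
  shows "(1 - s) * (- u x) + s * (- w z)
      \<le> (1 - s) * conjugate \<Omega> u y + s * conjugate \<Omega> w y - ((1 - s) *\<^sub>R x + s *\<^sub>R z) \<bullet> y"
proof -
  have "(1 - s) * (x \<bullet> y - u x) + s * (z \<bullet> y - w z) \<le> (1 - s) * conjugate \<Omega> u y + s * conjugate \<Omega> w y"
    using assms by (intro add_mono mult_left_mono U.conjugate_ge W.conjugate_ge) auto
  then show ?thesis by (simp add: inner_add_left algebra_simps)
qed

lemma interp_ge:
  assumes "0 \<le> s" "s \<le> 1" "x \<in> closure \<Omega>" "z \<in> closure \<Omega>"
  shows "(1 - s) * (- u x) + s * (- w z) \<le> interp s ((1 - s) *\<^sub>R x + s *\<^sub>R z)"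
  unfolding interp_def by (intro cINF_greatest interp_ge_raw assms) auto

lemma interp_ge_same:
  assumes "0 \<le> s" "s \<le> 1" "z \<in> closure \<Omega>"
  shows "(1 - s) * (- u z) + s * (- w z) \<le> interp s z"
  using interp_ge[OF assms(1,2,3,3)] by (simp flip: scaleR_add_left)

lemma interp_le:
  assumes "0 \<le> s" "s \<le> 1" "z \<in> closure \<Omega>"
  shows "interp s z \<le> (1 - s) * conjugate \<Omega> u y + s * conjugate \<Omega> w y - z \<bullet> y"
  unfolding interp_def
proof (rule cINF_lower)
  show "bdd_below (range (\<lambda>y. (1 - s) * conjugate \<Omega> u y + s * conjugate \<Omega> w y - z \<bullet> y))"
    using interp_ge_raw[OF assms(1,2,3,3)]
    by (intro bdd_belowI[of _ "(1 - s) * (- u z) + s * (- w z)"]) (auto simp flip: scaleR_add_left)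
qed simp

lemma closure_convex_comb:
  assumes "0 \<le> s" "s \<le> 1" "x \<in> closure \<Omega>" "z \<in> closure \<Omega>"
  shows "(1 - s) *\<^sub>R x + s *\<^sub>R z \<in> closure \<Omega>"
  using convexD_alt[OF convex_closure[OF U.convex_domain]] assms by blast

lemma interp_concave:
  assumes s: "0 \<le> s" "s \<le> 1" and r: "0 \<le> r" "r \<le> 1" and "x \<in> closure \<Omega>" "z \<in> closure \<Omega>"
  shows "(1 - r) * interp s x + r * interp s z \<le> interp s ((1 - r) *\<^sub>R x + r *\<^sub>R z)"
  unfolding interp_def[of s "(1 - r) *\<^sub>R x + r *\<^sub>R z"]
proof (intro cINF_greatest)
  fix y :: 'a
  let ?k = "(1 - s) * conjugate \<Omega> u y + s * conjugate \<Omega> w y"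
  have "(1 - r) * interp s x + r * interp s z \<le> (1 - r) * (?k - x \<bullet> y) + r * (?k - z \<bullet> y)"
    using assms by (intro add_mono mult_left_mono interp_le) auto
  also have "\<dots> = ?k - ((1 - r) *\<^sub>R x + r *\<^sub>R z) \<bullet> y"
    by (simp add: inner_add_left algebra_simps)
  finally show "(1 - r) * interp s x + r * interp s z \<le> ?k - ((1 - r) *\<^sub>R x + r *\<^sub>R z) \<bullet> y" .
qed simp

lemma interp_continuous:
  assumes "0 \<le> s" "s \<le> 1"
  shows "continuous_on \<Omega> (interp s)"
proof -
  have "convex_on \<Omega> (\<lambda>x. - interp s x)"
  proof (rule convex_onI)
    fix r :: real and x z assume "0 < r" "r < 1" "x \<in> \<Omega>" "z \<in> \<Omega>"
    then show "- interp s ((1 - r) *\<^sub>R x + r *\<^sub>R z) \<le> (1 - r) * - interp s x + r * - interp s z"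
      using interp_concave[of s r x z] assms U.in_closure by (simp add: algebra_simps)
  qed (fact U.convex_domain)
  then have "continuous_on \<Omega> (\<lambda>x. - interp s x)"
    using convex_on_continuous U.open_domain by blast
  then show ?thesis using continuous_on_minus[of \<Omega> "\<lambda>x. - interp s x"] by simp
qed

text \<open>Conjugates are interpolated linearly, so moving from \<open>u\<close> towards the point
  at time \<open>t\<close> by the fraction \<open>s\<close> leads to time \<open>s * t\<close> of
  the same path.\<close>

lemma interp_reparametrize:
  assumes s: "0 \<le> s" "s \<le> 1" and t: "0 \<le> t" "t \<le> 1" and x: "x \<in> closure \<Omega>" and z: "z \<in> closure \<Omega>"
  shows "(1 - s) * (- u x) + s * interp t z \<le> interp (s * t) ((1 - s) *\<^sub>R x + s *\<^sub>R z)"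
  unfolding interp_def[of "s * t"]
proof (intro cINF_greatest)
  fix y :: 'a
  have "(1 - s) * (x \<bullet> y - u x) + s * interp t z
      \<le> (1 - s) * conjugate \<Omega> u y + s * ((1 - t) * conjugate \<Omega> u y + t * conjugate \<Omega> w y - z \<bullet> y)"
    using assms by (intro add_mono mult_left_mono U.conjugate_ge interp_le) auto
  then show "(1 - s) * (- u x) + s * interp t z
      \<le> (1 - s * t) * conjugate \<Omega> u y + (s * t) * conjugate \<Omega> w y - ((1 - s) *\<^sub>R x + s *\<^sub>R z) \<bullet> y"
    by (simp add: inner_add_left algebra_simps)
qed simp

definition depth_sum :: real where "depth_sum = U.depth + W.depth"

lemma depth_sum: "0 < depth_sum" "U.depth \<le> depth_sum" "W.depth \<le> depth_sum"
  using U.depth(1) W.depth(1) by (auto simp: depth_sum_def)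

lemma interp_pos:
  assumes "0 \<le> s" "s \<le> 1" "z \<in> \<Omega>"
  shows "0 < interp s z"
proof -
  have "0 < (1 - s) * (- u z) + s * (- w z)"
  proof (cases "s = 1")
    case True
    then show ?thesis using W.bounds(1)[OF assms(3)] by simp
  next
    case False
    then have "0 < (1 - s) * (- u z)"
      using assms U.bounds(1)[OF assms(3)] by (intro mult_pos_pos) auto
    moreover have "0 \<le> s * (- w z)"
      using assms W.bounds(1)[OF assms(3)] by (intro mult_nonneg_nonneg) auto
    ultimately show ?thesis by linarith
  qed
  also have "\<dots> \<le> interp s z"
    using assms U.in_closure by (intro interp_ge_same) auto
  finally show ?thesis .
qed

lemma conjugate_0_le: "conjugate \<Omega> u 0 \<le> depth_sum" "conjugate \<Omega> w 0 \<le> depth_sum"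
proof -
  show "conjugate \<Omega> u 0 \<le> depth_sum"
    using U.depth(2) depth_sum(2) by (intro U.conjugate_le) (simp, meson order_trans)
  show "conjugate \<Omega> w 0 \<le> depth_sum"
    using W.depth(2) depth_sum(3) by (intro W.conjugate_le) (simp, meson order_trans)
qed

lemma interp_le_K:
  assumes "0 \<le> s" "s \<le> 1" "z \<in> closure \<Omega>"
  shows "interp s z \<le> depth_sum"
proof -
  have "interp s z \<le> (1 - s) * conjugate \<Omega> u 0 + s * conjugate \<Omega> w 0 - z \<bullet> 0"
    by (rule interp_le[OF assms])
  also have "\<dots> \<le> (1 - s) * depth_sum + s * depth_sum - z \<bullet> 0"
    using assms conjugate_0_le by (intro diff_right_mono add_mono mult_left_mono) auto
  also have "\<dots> = depth_sum" by (simp add: algebra_simps)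
  finally show ?thesis .
qed

text \<open>The infimum is tested at a subgradient of \<open>u\<close>, where Young-Fenchel is an
  equality. This is the one-sided first variation of the Legendre transform.\<close>

lemma interp_subdifferential:
  assumes "0 \<le> s" "s \<le> 1" "x \<in> \<Omega>" "y \<in> subdifferential \<Omega> u x"
  shows "interp s x + u x \<le> s * (conjugate \<Omega> w y - conjugate \<Omega> u y)"
proof -
  have e: "x \<bullet> y = conjugate \<Omega> u y + u x"
    using U.conjugate_subdifferential[OF assms(3,4)] by simp
  show ?thesis
    using interp_le[OF assms(1,2) U.in_closure[OF assms(3)], of y]
    unfolding e by (simp add: algebra_simps)
qed

lemma conjugate_diff: "conjugate \<Omega> w y - conjugate \<Omega> u y = conjugate_gap \<Omega> w y - conjugate_gap \<Omega> u y"
  by (simp add: conjugate_gap_def)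

lemma conjugate_diff_bound: "\<bar>conjugate \<Omega> w y - conjugate \<Omega> u y\<bar> \<le> depth_sum"
  using U.gap_nonneg[of y] W.gap_nonneg[of y] U.gap_le[of y] W.gap_le[of y] U.depth(1) W.depth(1)
  unfolding conjugate_diff depth_sum_def by linarith

text \<open>The upper bound is clear at points that have a subgradient. Points violating it would
  form a nonempty open set, whose subdifferential image has positive measure and hence is not
  empty.\<close>

lemma interp_diff_bound:
  assumes s: "0 \<le> s" "s \<le> 1" and x: "x \<in> \<Omega>"
  shows "\<bar>interp s x + u x\<bar> \<le> s * depth_sum"
proof -
  have "interp s z + u z \<le> s * depth_sum" if z: "z \<in> \<Omega>" for z
  proof (rule ccontr)
    assume *: "\<not> interp s z + u z \<le> s * depth_sum"
    define E where "E = {z \<in> \<Omega>. s * depth_sum < interp s z + u z}"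
    have "open E"
      unfolding E_def
      by (intro U.open_Collect_less_domain continuous_intros interp_continuous s U.continuous_domain)
    moreover have "E \<subseteq> \<Omega>" "E \<noteq> {}" using * z by (auto simp: E_def)
    ultimately have "0 < emeasure lebesgue (subdifferential_image \<Omega> u E)"
      by (rule U.subdifferential_image_pos)
    then have "subdifferential_image \<Omega> u E \<noteq> {}" by (metis emeasure_empty less_irrefl)
    then obtain v y where v: "v \<in> E" "y \<in> subdifferential \<Omega> u v"
      by (auto simp: subdifferential_image_def)
    then have "interp s v + u v \<le> s * (conjugate \<Omega> w y - conjugate \<Omega> u y)"
      using s by (intro interp_subdifferential) (auto simp: E_def)
    also have "\<dots> \<le> s * depth_sum"
      using conjugate_diff_bound[of y] s by (intro mult_left_mono) auto
    finally show False using v by (simp add: E_def)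
  qed
  moreover have "- (s * depth_sum) \<le> interp s x + u x"
  proof -
    have "s * (- u x) \<le> s * depth_sum"
      using s U.bounds(2)[OF x] depth_sum by (intro mult_left_mono) auto
    moreover have "0 \<le> s * (- w x)"
      using s W.bounds(1)[OF x] by (intro mult_nonneg_nonneg) auto
    ultimately show ?thesis
      using interp_ge_same[OF s U.in_closure[OF x]] by (simp add: algebra_simps)
  qed
  ultimately show ?thesis using x by (simp add: abs_le_iff)
qed

text \<open>If \<open>y\<close> is a subgradient at \<open>x\<close>, then \<open>interp s x + u x\<close> is at most \<open>s\<close> times the difference of the
  conjugates at \<open>y\<close>. So the superlevel sets of the former have subdifferential images inside the
  superlevel sets of the latter, and the layer cake formula turns the equation into an integral
  inequality, without any change of variables for the multivalued gradient.\<close>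

lemma first_order:
  assumes s: "0 \<le> s" "s \<le> 1"
  shows "(\<integral>x. indicator \<Omega> x * ((- u x) powr p * (interp s x + u x)) \<partial>lborel) \<le> 0"
proof -
  define S where "S = subdifferential_image \<Omega> u \<Omega>"
  define d where "d y = s * (conjugate_gap \<Omega> w y - conjugate_gap \<Omega> u y)" for y
  define \<delta> where "\<delta> x = interp s x + u x" for x
  have S: "S \<in> sets lebesgue" "emeasure lebesgue S < \<infinity>"
    unfolding S_def using U.subdifferential_image_measurable[OF U.open_domain] U.subdifferential_image_finite by auto
  have intS: "integrable lebesgue (\<lambda>y. indicator S y :: real)"
    using S by (intro integrable_real_indicator) auto
  have gap: "integrable lebesgue (\<lambda>y. conjugate_gap \<Omega> w y)" "integrable lebesgue (\<lambda>y. conjugate_gap \<Omega> u y)"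
    using U.gap_integrable W.gap_integrable by (simp_all add: integrable_completion)
  have gapS: "integrable lebesgue (\<lambda>y. indicator S y * conjugate_gap \<Omega> w y)"
    "integrable lebesgue (\<lambda>y. indicator S y * conjugate_gap \<Omega> u y)"
    using integrable_mult_indicator[OF S(1) gap(1)] integrable_mult_indicator[OF S(1) gap(2)] by simp_all
  have dS: "integrable lebesgue (\<lambda>y. indicator S y * d y)"
    using integrable_mult_right[OF Bochner_Integration.integrable_diff[OF gapS], of s]
    by (simp add: d_def algebra_simps)
  \<comment> \<open>Off \<open>S\<close> the gap of \<open>u\<close> vanishes and that of
    \<open>w\<close> is nonnegative. Hence equality of the two volumes leaves at most 0 for the
    integral of \<open>d\<close> over \<open>S\<close>.\<close>
  have "(\<integral>y. indicator S y * conjugate_gap \<Omega> w y \<partial>lebesgue) \<le> (\<integral>y. conjugate_gap \<Omega> w y \<partial>lebesgue)"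
    using W.gap_nonneg by (intro integral_mono gapS gap) (auto simp: indicator_def)
  also have "\<dots> = conjugate_volume \<Omega> w"
    by (simp add: conjugate_volume_def integral_completion)
  also have "\<dots> = (\<integral>y. conjugate_gap \<Omega> u y \<partial>lebesgue)"
    using volume_eq by (simp add: conjugate_volume_def integral_completion)
  also have "\<dots> = (\<integral>y. indicator S y * conjugate_gap \<Omega> u y \<partial>lebesgue)"
    using U.gap_eq_0 by (intro Bochner_Integration.integral_cong) (auto simp: indicator_def S_def)
  finally have "s * ((\<integral>y. indicator S y * conjugate_gap \<Omega> w y \<partial>lebesgue)
      - (\<integral>y. indicator S y * conjugate_gap \<Omega> u y \<partial>lebesgue)) \<le> 0"
    using s by (intro mult_nonneg_nonpos) auto
  also have "s * ((\<integral>y. indicator S y * conjugate_gap \<Omega> w y \<partial>lebesgue)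
      - (\<integral>y. indicator S y * conjugate_gap \<Omega> u y \<partial>lebesgue)) = (\<integral>y. indicator S y * d y \<partial>lebesgue)"
    using gapS by (simp add: d_def right_diff_distrib mult.left_commute[of _ s])
  finally have d_le: "(\<integral>y. indicator S y * d y \<partial>lebesgue) \<le> 0" .
  \<comment> \<open>The layer cake formula sees positive parts only, so \<delta> and
    \<open>d\<close> are both shifted by \<open>depth_sum\<close> to become nonnegative.\<close>
  have d_ge: "- depth_sum \<le> d y" for y
  proof -
    have "\<bar>d y\<bar> \<le> 1 * depth_sum"
      unfolding d_def abs_mult using s conjugate_diff_bound[of y]
      by (intro mult_mono) (auto simp: conjugate_diff)
    then show ?thesis by simp
  qed
  have \<delta>: "\<bar>\<delta> x\<bar> \<le> depth_sum" if "x \<in> \<Omega>" for x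
  proof -
    have "s * depth_sum \<le> 1 * depth_sum" using s(2) depth_sum(1) by (intro mult_right_mono) auto
    then show ?thesis using interp_diff_bound[OF s that] by (simp add: \<delta>_def)
  qed
  have \<delta>_cont: "continuous_on \<Omega> \<delta>"
    unfolding \<delta>_def by (intro continuous_intros interp_continuous s U.continuous_domain)
  define a where "a = (\<lambda>x. indicator \<Omega> x * (- u x) powr p)"
  have a: "integrable lborel a" "a \<in> borel_measurable borel" "\<And>x. 0 \<le> a x"
    using U.integrable_power[of p] U.p U.density_borel[of p] by (auto simp: a_def)
  \<comment> \<open>The Monge-Ampere measure of \<open>u\<close>, written by the equation as a
    density; its total mass is the measure of \<open>S\<close>.\<close>
  define N where "N = density lborel (\<lambda>x. ennreal (c0 * a x))"
  have N_fin: "emeasure N (space N) = emeasure lebesgue S"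
  proof -
    have "emeasure N (space N) = (\<integral>\<^sup>+x. ennreal (c0 * a x) \<partial>lborel)"
      using a by (simp add: N_def emeasure_density)
    also have "\<dots> = ennreal (c0 * integral\<^sup>L lborel a)"
      using a U.c by (simp add: nn_integral_eq_integral)
    also have "\<dots> = emeasure lebesgue S"
      by (simp add: S_def U.total_measure power_mass_def a_def)
    finally show ?thesis .
  qed
  interpret N: finite_measure N
    by standard (use N_fin S in auto)
  have f_borel: "(\<lambda>x. indicator \<Omega> x * (\<delta> x + depth_sum)) \<in> borel_measurable borel"
    by (intro U.borel_domain continuous_intros \<delta>_cont)
  have g_int: "integrable lebesgue (\<lambda>y. indicator S y * (d y + depth_sum))"
    using Bochner_Integration.integrable_add[OF dS integrable_mult_right[OF intS, of depth_sum]]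
    by (simp add: algebra_simps)
  have "(\<integral>\<^sup>+x. ennreal (indicator \<Omega> x * (\<delta> x + depth_sum)) \<partial>N) \<le> (\<integral>\<^sup>+y. ennreal (indicator S y * (d y + depth_sum)) \<partial>lebesgue)"
  proof (rule nn_integral_mono_layer_cake)
    show "sigma_finite_measure N" by unfold_locales
    show "sigma_finite_measure (lebesgue :: 'a measure)" by (rule sigma_finite_lebesgue)
    show "(\<lambda>x. indicator \<Omega> x * (\<delta> x + depth_sum)) \<in> borel_measurable N"
      using f_borel by (simp add: N_def)
    show "(\<lambda>y. indicator S y * (d y + depth_sum)) \<in> borel_measurable lebesgue"
      using g_int by auto
    fix r :: real assume r: "0 \<le> r"
    define E where "E = {x \<in> \<Omega>. r < \<delta> x + depth_sum}"
    have E: "{x \<in> space N. r < indicator \<Omega> x * (\<delta> x + depth_sum)} = E"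
      using r by (auto simp: E_def N_def indicator_def)
    have "open E"
      unfolding E_def
      by (intro U.open_Collect_less_domain continuous_intros \<delta>_cont)
    then have Eb: "E \<in> sets borel" "E \<subseteq> \<Omega>" by (auto simp: E_def)
    have "emeasure N E = (\<integral>\<^sup>+x\<in>E. ennreal (c0 * (- u x) powr p) \<partial>lborel)"
      using a Eb by (simp add: N_def emeasure_density a_def U.density_indicator)
    also have "\<dots> = emeasure lebesgue (subdifferential_image \<Omega> u E)"
      using U.monge_ampere_eq[OF Eb] by simp
    also have "\<dots> \<le> emeasure lebesgue {y \<in> space lebesgue. r < indicator S y * (d y + depth_sum)}"
    proof (rule emeasure_mono)
      show "{y \<in> space lebesgue. r < indicator S y * (d y + depth_sum)} \<in> sets lebesgue"
        using g_int by measurable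
      show "subdifferential_image \<Omega> u E \<subseteq> {y \<in> space lebesgue. r < indicator S y * (d y + depth_sum)}"
      proof
        fix y assume "y \<in> subdifferential_image \<Omega> u E"
        then obtain x where x: "x \<in> E" "y \<in> subdifferential \<Omega> u x"
          by (auto simp: subdifferential_image_def)
        then have "y \<in> S" by (auto simp: S_def subdifferential_image_def E_def)
        moreover have "\<delta> x \<le> d y"
          using interp_subdifferential[OF s _ x(2)] x(1) by (auto simp: E_def \<delta>_def d_def conjugate_diff)
        ultimately show "y \<in> {y \<in> space lebesgue. r < indicator S y * (d y + depth_sum)}"
          using x(1) by (auto simp: E_def)
      qed
    qed
    finally show "emeasure N {x \<in> space N. r < indicator \<Omega> x * (\<delta> x + depth_sum)}
        \<le> emeasure lebesgue {y \<in> space lebesgue. r < indicator S y * (d y + depth_sum)}"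
      unfolding E .
  qed
  also have "\<dots> = ennreal (\<integral>y. indicator S y * (d y + depth_sum) \<partial>lebesgue)"
  proof (rule nn_integral_eq_integral[OF g_int AE_I2])
    fix y show "0 \<le> indicator S y * (d y + depth_sum)" using d_ge[of y] by (simp add: indicator_def)
  qed
  also have "(\<integral>\<^sup>+x. ennreal (indicator \<Omega> x * (\<delta> x + depth_sum)) \<partial>N)
      = (\<integral>\<^sup>+x. ennreal (c0 * (indicator \<Omega> x * ((- u x) powr p * (\<delta> x + depth_sum)))) \<partial>lborel)"
  proof -
    have "(\<integral>\<^sup>+x. ennreal (indicator \<Omega> x * (\<delta> x + depth_sum)) \<partial>N)
        = (\<integral>\<^sup>+x. ennreal (c0 * a x) * ennreal (indicator \<Omega> x * (\<delta> x + depth_sum)) \<partial>lborel)"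
      unfolding N_def using a(2) f_borel by (intro nn_integral_density) auto
    also have "\<dots> = (\<integral>\<^sup>+x. ennreal (c0 * (indicator \<Omega> x * ((- u x) powr p * (\<delta> x + depth_sum)))) \<partial>lborel)"
    proof (rule nn_integral_cong)
      fix x :: 'a
      have "0 \<le> c0 * a x" using U.c a(3) by simp
      then have "ennreal (c0 * a x) * ennreal (indicator \<Omega> x * (\<delta> x + depth_sum))
          = ennreal (c0 * a x * (indicator \<Omega> x * (\<delta> x + depth_sum)))"
        by (simp only: ennreal_mult')
      also have "c0 * a x * (indicator \<Omega> x * (\<delta> x + depth_sum)) = c0 * (indicator \<Omega> x * ((- u x) powr p * (\<delta> x + depth_sum)))"
        by (simp add: a_def indicator_def)
      finally show "ennreal (c0 * a x) * ennreal (indicator \<Omega> x * (\<delta> x + depth_sum))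
          = ennreal (c0 * (indicator \<Omega> x * ((- u x) powr p * (\<delta> x + depth_sum))))" .
    qed
    finally show ?thesis .
  qed
  also have "\<dots> = ennreal (\<integral>x. c0 * (indicator \<Omega> x * ((- u x) powr p * (\<delta> x + depth_sum))) \<partial>lborel)"
  proof (rule nn_integral_eq_integral[OF _ AE_I2])
    show "integrable lborel (\<lambda>x. c0 * (indicator \<Omega> x * ((- u x) powr p * (\<delta> x + depth_sum))))"
    proof (intro integrable_mult_right U.integrable_domain)
      show "continuous_on \<Omega> (\<lambda>x. (- u x) powr p * (\<delta> x + depth_sum))"
        using U.negative by (intro continuous_intros U.continuous_domain \<delta>_cont) force
      fix x assume x: "x \<in> \<Omega>"
      show "\<bar>(- u x) powr p * (\<delta> x + depth_sum)\<bar> \<le> U.depth powr p * (depth_sum + depth_sum)"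
        unfolding abs_mult using \<delta>[OF x] U.bounds[OF x] U.p depth_sum(1)
        by (intro mult_mono) (auto intro!: powr_mono2)
    qed
    fix x show "0 \<le> c0 * (indicator \<Omega> x * ((- u x) powr p * (\<delta> x + depth_sum)))"
      using \<delta>[of x] U.c by (cases "x \<in> \<Omega>") (auto simp: abs_le_iff)
  qed
  finally have "(\<integral>x. c0 * (indicator \<Omega> x * ((- u x) powr p * (\<delta> x + depth_sum))) \<partial>lborel)
      \<le> (\<integral>y. indicator S y * (d y + depth_sum) \<partial>lebesgue)"
  proof (subst (asm) ennreal_le_iff)
    show "0 \<le> (\<integral>y. indicator S y * (d y + depth_sum) \<partial>lebesgue)"
    proof (rule Bochner_Integration.integral_nonneg)
      fix y show "0 \<le> indicator S y * (d y + depth_sum)" using d_ge[of y] by (simp add: indicator_def)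
    qed
  qed
  \<comment> \<open>The shift contributes \<open>depth_sum\<close> times the same total mass on both
    sides and cancels.\<close>
  also have "\<dots> = (\<integral>y. indicator S y * d y \<partial>lebesgue) + depth_sum * measure lebesgue S"
    using dS intS S by (simp add: distrib_left mult.commute[of _ depth_sum])
  also have "\<dots> \<le> depth_sum * measure lebesgue S" using d_le by simp
  also have "measure lebesgue S = c0 * integral\<^sup>L lborel a"
    using U.total_measure U.c a(3) unfolding S_def measure_def
    by (simp add: power_mass_def a_def)
  also have "(\<integral>x. c0 * (indicator \<Omega> x * ((- u x) powr p * (\<delta> x + depth_sum))) \<partial>lborel)
      = c0 * (\<integral>x. indicator \<Omega> x * ((- u x) powr p * \<delta> x) \<partial>lborel) + depth_sum * (c0 * integral\<^sup>L lborel a)"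
  proof -
    have i: "integrable lborel (\<lambda>x. indicator \<Omega> x * ((- u x) powr p * \<delta> x))"
    proof (rule U.integrable_domain)
      show "continuous_on \<Omega> (\<lambda>x. (- u x) powr p * \<delta> x)"
        using U.negative by (intro continuous_intros U.continuous_domain \<delta>_cont) force
      fix x assume x: "x \<in> \<Omega>"
      show "\<bar>(- u x) powr p * \<delta> x\<bar> \<le> U.depth powr p * depth_sum"
        unfolding abs_mult using \<delta>[OF x] U.bounds[OF x] U.p depth_sum(1)
        by (intro mult_mono) (auto intro!: powr_mono2)
    qed
    have e: "indicator \<Omega> x * ((- u x) powr p * (\<delta> x + depth_sum))
        = indicator \<Omega> x * ((- u x) powr p * \<delta> x) + depth_sum * a x" for x
      by (simp add: a_def algebra_simps)
    show ?thesis
      unfolding e integral_mult_right_zero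
      using i a(1) by (subst Bochner_Integration.integral_add) (auto simp: distrib_left)
  qed
  finally have "c0 * (\<integral>x. indicator \<Omega> x * ((- u x) powr p * \<delta> x) \<partial>lborel) \<le> 0" by simp
  then show ?thesis using U.c by (simp add: \<delta>_def mult_le_0_iff)
qed

end

section \<open>Comparing power masses along the path\<close>

text \<open>Taking q-th powers commutes with geometric means. Extension by zero is harmless because
  a zero factor annihilates the left side and convexity keeps the combination inside.\<close>

lemma (in power_solution) power_mass_prekopa_leindler:
  fixes f g h :: "'a \<Rightarrow> real"
  assumes meas: "(\<lambda>x. indicator \<Omega> x * f x powr q) \<in> borel_measurable borel"
      "(\<lambda>x. indicator \<Omega> x * g x powr q) \<in> borel_measurable borel"
      "(\<lambda>x. indicator \<Omega> x * h x powr q) \<in> borel_measurable borel"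
    and q: "0 < q" and s: "0 < s" "s < 1"
    and bounds: "\<And>x. x \<in> \<Omega> \<Longrightarrow> 0 \<le> f x" "\<And>x. x \<in> \<Omega> \<Longrightarrow> f x \<le> C" "\<And>x. x \<in> \<Omega> \<Longrightarrow> 0 \<le> g x" "\<And>x. x \<in> \<Omega> \<Longrightarrow> g x \<le> C"
      "\<And>x. x \<in> \<Omega> \<Longrightarrow> 0 \<le> h x" "\<And>x. x \<in> \<Omega> \<Longrightarrow> h x \<le> C"
    and le: "\<And>x y. x \<in> \<Omega> \<Longrightarrow> y \<in> \<Omega> \<Longrightarrow> f x powr (1 - s) * g y powr s \<le> h ((1 - s) *\<^sub>R x + s *\<^sub>R y)"
  shows "power_mass \<Omega> q f powr (1 - s) * power_mass \<Omega> q g powr s \<le> power_mass \<Omega> q h"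
proof -
  obtain R where R: "\<And>x. x \<in> \<Omega> \<Longrightarrow> norm x \<le> R"
    using bounded_domain unfolding bounded_iff by blast
  have bd: "indicator \<Omega> x * k x powr q \<le> C powr q" if "\<And>x. x \<in> \<Omega> \<Longrightarrow> 0 \<le> k x" "\<And>x. x \<in> \<Omega> \<Longrightarrow> k x \<le> C"
    for k :: "'a \<Rightarrow> real" and x
    using that[of x] q by (cases "x \<in> \<Omega>") (auto intro: powr_mono2)
  show ?thesis
    unfolding power_mass_def
  proof (rule prekopa_leindler[OF meas, where C = "C powr q"])
    fix x y :: 'a
    show "0 < s" "s < 1" by (fact s)+
    show "indicator \<Omega> x * f x powr q \<le> C powr q" by (rule bd) (simp_all add: bounds)
    show "indicator \<Omega> x * g x powr q \<le> C powr q" by (rule bd) (simp_all add: bounds)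
    show "indicator \<Omega> x * h x powr q \<le> C powr q" by (rule bd) (simp_all add: bounds)
    show "0 \<le> indicator \<Omega> x * f x powr q" "0 \<le> indicator \<Omega> x * g x powr q" "0 \<le> indicator \<Omega> x * h x powr q"
      by auto
    show "norm x \<le> R" if "indicator \<Omega> x * f x powr q \<noteq> 0" using that R by (auto simp: indicator_def split: if_splits)
    show "norm x \<le> R" if "indicator \<Omega> x * g x powr q \<noteq> 0" using that R by (auto simp: indicator_def split: if_splits)
    show "norm x \<le> R" if "indicator \<Omega> x * h x powr q \<noteq> 0" using that R by (auto simp: indicator_def split: if_splits)
    show "(indicator \<Omega> x * f x powr q) powr (1 - s) * (indicator \<Omega> y * g y powr q) powr s
        \<le> indicator \<Omega> ((1 - s) *\<^sub>R x + s *\<^sub>R y) * h ((1 - s) *\<^sub>R x + s *\<^sub>R y) powr q"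
    proof (cases "x \<in> \<Omega> \<and> y \<in> \<Omega>")
      case True
      then have z: "(1 - s) *\<^sub>R x + s *\<^sub>R y \<in> \<Omega>"
        using convexD_alt[OF convex_domain] s by auto
      have "(f x powr (1 - s) * g y powr s) powr q \<le> h ((1 - s) *\<^sub>R x + s *\<^sub>R y) powr q"
        using le True q by (intro powr_mono2) auto
      then show ?thesis using True z by (simp add: powr_mult powr_powr mult.commute)
    qed (auto simp: indicator_def)
  qed
qed

context solution_pair
begin

lemma interp_power_continuous:
  assumes "0 \<le> s" "s \<le> 1"
  shows "continuous_on \<Omega> (\<lambda>x. interp s x powr q)"
  using interp_pos[OF assms] by (intro continuous_intros interp_continuous assms) force

lemma interp_power_integrable:
  assumes "0 \<le> s" "s \<le> 1" "0 \<le> q"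
  shows "integrable lborel (\<lambda>x. indicator \<Omega> x * interp s x powr q)"
proof (rule U.integrable_domain[OF interp_power_continuous[OF assms(1,2)]])
  fix x assume "x \<in> \<Omega>"
  then show "\<bar>interp s x powr q\<bar> \<le> depth_sum powr q"
    using interp_le_K[OF assms(1,2) U.in_closure, of x] interp_pos[OF assms(1,2), of x] assms(3)
    by (auto intro: powr_mono2)
qed

text \<open>Taylor expansion at \<open>- u\<close>: the linear term integrates to something
  nonpositive by \<open>first_order\<close>, and the remainder is quadratic because
  \<open>interp s\<close> stays within \<open>s * depth_sum\<close> of \<open>- u\<close>.\<close>

lemma mass_upper:
  obtains C where "0 \<le> C"
    "\<And>s. 0 \<le> s \<Longrightarrow> s \<le> 1 \<Longrightarrow> power_mass \<Omega> (p + 1) (interp s) \<le> power_mass \<Omega> (p + 1) (\<lambda>x. - u x) + C * s\<^sup>2"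
proof
  define B where "B = (p + 1) * p * depth_sum powr (p - 1) * depth_sum\<^sup>2"
  have B: "0 \<le> B" using U.p by (simp add: B_def)
  show "0 \<le> B * measure lborel \<Omega>" using B by simp
  fix s :: real assume s: "0 \<le> s" "s \<le> 1"
  let ?a = "\<lambda>x. indicator \<Omega> x * (- u x) powr (p + 1)"
  let ?b = "\<lambda>x. indicator \<Omega> x * ((- u x) powr p * (interp s x + u x))"
  have a: "integrable lborel ?a" using U.p by (intro U.integrable_power) simp
  have b: "integrable lborel ?b"
  proof (rule U.integrable_domain)
    show "continuous_on \<Omega> (\<lambda>x. (- u x) powr p * (interp s x + u x))"
      using U.negative by (intro continuous_intros U.continuous_domain interp_continuous s) force
    fix x assume x: "x \<in> \<Omega>"
    show "\<bar>(- u x) powr p * (interp s x + u x)\<bar> \<le> U.depth powr p * (s * depth_sum)"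
      unfolding abs_mult using interp_diff_bound[OF s x] U.bounds[OF x] U.p
      by (intro mult_mono) (auto intro!: powr_mono2)
  qed
  have i: "integrable lborel (\<lambda>x. indicator \<Omega> x :: real)"
    using U.open_domain emeasure_bounded_finite[OF U.bounded_domain] by (intro integrable_real_indicator) auto
  have "indicator \<Omega> x * interp s x powr (p + 1) \<le> ?a x + (p + 1) * ?b x + B * s\<^sup>2 * indicator \<Omega> x" for x
  proof (cases "x \<in> \<Omega>")
    case True
    have "interp s x powr (p + 1) \<le> (- u x) powr (p + 1) + (p + 1) * (- u x) powr p * (interp s x - (- u x))
        + (p + 1) * p * depth_sum powr (p - 1) * (interp s x - (- u x))\<^sup>2"
      using interp_pos[OF s True] interp_le_K[OF s U.in_closure[OF True]] U.bounds[OF True] depth_sum U.p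
      by (intro powr_taylor_upper) auto
    moreover have "(interp s x - (- u x))\<^sup>2 \<le> (s * depth_sum)\<^sup>2"
      using interp_diff_bound[OF s True] power_mono[of "\<bar>interp s x + u x\<bar>" "s * depth_sum" 2] by simp
    then have "(p + 1) * p * depth_sum powr (p - 1) * (interp s x - (- u x))\<^sup>2 \<le> (p + 1) * p * depth_sum powr (p - 1) * (s * depth_sum)\<^sup>2"
      using U.p by (intro mult_left_mono) auto
    ultimately show ?thesis using True by (simp add: B_def power_mult_distrib algebra_simps)
  qed simp
  then have "(\<integral>x. indicator \<Omega> x * interp s x powr (p + 1) \<partial>lborel)
      \<le> (\<integral>x. ?a x + (p + 1) * ?b x + B * s\<^sup>2 * indicator \<Omega> x \<partial>lborel)"
    using U.p by (intro integral_mono interp_power_integrable s Bochner_Integration.integrable_add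
        integrable_mult_right a b i) auto
  also have "\<dots> = (\<integral>x. ?a x \<partial>lborel) + (p + 1) * (\<integral>x. ?b x \<partial>lborel) + B * s\<^sup>2 * measure lborel \<Omega>"
    using a b i U.open_domain by simp
  also have "\<dots> \<le> (\<integral>x. ?a x \<partial>lborel) + B * s\<^sup>2 * measure lborel \<Omega>"
    using first_order[OF s] U.p by (simp add: mult_nonneg_nonpos)
  finally show "power_mass \<Omega> (p + 1) (interp s) \<le> power_mass \<Omega> (p + 1) (\<lambda>x. - u x) + B * measure lborel \<Omega> * s\<^sup>2"
    by (simp add: power_mass_def mult_ac)
qed

text \<open>Prekopa-Leindler between \<open>- u\<close> and the path point at time \<open>t\<close>;
  the required geometric means lie below the arithmetic means that
  \<open>interp_reparametrize\<close> bounds.\<close>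

lemma mass_lower:
  assumes s: "0 < s" "s < 1" and t: "0 \<le> t" "t \<le> 1"
  shows "power_mass \<Omega> (p + 1) (\<lambda>x. - u x) powr (1 - s) * power_mass \<Omega> (p + 1) (interp t) powr s
      \<le> power_mass \<Omega> (p + 1) (interp (s * t))"
proof (rule U.power_mass_prekopa_leindler[where C = depth_sum])
  have st: "0 \<le> s * t" "s * t \<le> 1" using s t by (auto simp: mult_le_one)
  show "(\<lambda>x. indicator \<Omega> x * (- u x) powr (p + 1)) \<in> borel_measurable borel" by (rule U.density_borel)
  show "(\<lambda>x. indicator \<Omega> x * interp t x powr (p + 1)) \<in> borel_measurable borel"
    "(\<lambda>x. indicator \<Omega> x * interp (s * t) x powr (p + 1)) \<in> borel_measurable borel"
    using t st by (auto intro!: U.borel_domain interp_power_continuous)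
  show "0 < p + 1" "0 < s" "s < 1" using U.p s by auto
  fix x assume x: "x \<in> \<Omega>"
  show "0 \<le> - u x" "- u x \<le> depth_sum" "0 \<le> interp t x" "interp t x \<le> depth_sum" "0 \<le> interp (s * t) x" "interp (s * t) x \<le> depth_sum"
    using U.bounds[OF x] depth_sum interp_pos[OF t x] interp_pos[OF st x]
      interp_le_K[OF t U.in_closure[OF x]] interp_le_K[OF st U.in_closure[OF x]] by auto
  fix y assume y: "y \<in> \<Omega>"
  have "(- u x) powr (1 - s) * interp t y powr s \<le> (1 - s) * (- u x) + s * interp t y"
    using U.bounds(1)[OF x] interp_pos[OF t y] s by (intro weighted_arith_geom_mean) auto
  also have "\<dots> \<le> interp (s * t) ((1 - s) *\<^sub>R x + s *\<^sub>R y)"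
    using s t x y U.in_closure by (intro interp_reparametrize) auto
  finally show "(- u x) powr (1 - s) * interp t y powr s \<le> interp (s * t) ((1 - s) *\<^sub>R x + s *\<^sub>R y)" .
qed

text \<open>Log-concavity along the path against an upper bound that has no first-order term.\<close>

lemma mass_interp_le:
  assumes t: "0 \<le> t" "t \<le> 1"
  shows "power_mass \<Omega> (p + 1) (interp t) \<le> power_mass \<Omega> (p + 1) (\<lambda>x. - u x)"
proof (rule ccontr)
  define F where "F = power_mass \<Omega> (p + 1) (\<lambda>x. - u x)"
  define H where "H = power_mass \<Omega> (p + 1) (interp t)"
  assume "\<not> ?thesis"
  then have FH: "F < H" by (simp add: F_def H_def)
  have F: "0 < F" unfolding F_def using U.p by (intro U.power_mass_pos) simp
  define \<kappa> where "\<kappa> = ln (H / F)"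
  have \<kappa>: "0 < \<kappa>" using FH F by (simp add: \<kappa>_def)
  obtain C where C: "0 \<le> C"
    "\<And>s. 0 \<le> s \<Longrightarrow> s \<le> 1 \<Longrightarrow> power_mass \<Omega> (p + 1) (interp s) \<le> F + C * s\<^sup>2"
    using mass_upper unfolding F_def by blast
  \<comment> \<open>Small enough for \<open>C * s < F * \<kappa>\<close>, which contradicts
    \<open>F * (1 + \<kappa> * s) \<le> F + C * s * s\<close>; the summand
    \<open>F * \<kappa>\<close> in the denominator keeps \<open>s\<close> below 1 when
    \<open>C\<close> is small.\<close>
  define s where "s = F * \<kappa> / (2 * (C + F * \<kappa>))"
  have F\<kappa>: "0 < F * \<kappa>" using F \<kappa> by simp
  have s: "0 < s" "s < 1" using F\<kappa> C(1) by (auto simp: s_def divide_less_eq intro!: divide_pos_pos)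
  have Cs: "C * s < F * \<kappa>"
  proof -
    have "C * s \<le> (C + F * \<kappa>) * s" using s F\<kappa> by (intro mult_right_mono) auto
    also have "\<dots> = F * \<kappa> / 2" using F\<kappa> C(1) by (simp add: s_def field_simps)
    also have "\<dots> < F * \<kappa>" using F\<kappa> by simp
    finally show ?thesis .
  qed
  have "F + F * (\<kappa> * s) = F * (1 + \<kappa> * s)" by (simp add: algebra_simps)
  also have "\<dots> \<le> F * exp (\<kappa> * s)" using F by (intro mult_left_mono) auto
  also have "exp (\<kappa> * s) = (H / F) powr s"
    using FH F by (simp add: \<kappa>_def powr_def mult.commute)
  also have "F * (H / F) powr s = F powr (1 - s) * H powr s"
    using FH F by (simp add: powr_divide powr_diff)
  also have "\<dots> \<le> power_mass \<Omega> (p + 1) (interp (s * t))"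
    unfolding F_def H_def by (rule mass_lower[OF s t])
  also have "\<dots> \<le> F + C * (s * t)\<^sup>2"
    using s t by (intro C) (auto simp: mult_le_one)
  also have "(s * t)\<^sup>2 \<le> s\<^sup>2"
    using s t by (intro power_mono) (auto simp: mult_left_le)
  then have "F + C * (s * t)\<^sup>2 \<le> F + C * s\<^sup>2" using C(1) by (intro add_left_mono mult_left_mono)
  finally have "F * \<kappa> * s \<le> C * s * s" by (simp add: power2_eq_square mult.assoc)
  then have "F * \<kappa> \<le> C * s" using s by (simp add: mult_le_cancel_right)
  then show False using Cs by simp
qed

lemma mass_w_le: "power_mass \<Omega> (p + 1) (\<lambda>x. - w x) \<le> power_mass \<Omega> (p + 1) (\<lambda>x. - u x)"
proof -
  have "power_mass \<Omega> (p + 1) (\<lambda>x. - w x) \<le> power_mass \<Omega> (p + 1) (interp 1)"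
    unfolding power_mass_def
  proof (intro integral_mono W.integrable_power interp_power_integrable)
    fix x
    show "indicator \<Omega> x * (- w x) powr (p + 1) \<le> indicator \<Omega> x * interp 1 x powr (p + 1)"
    proof (cases "x \<in> \<Omega>")
      case True
      then show ?thesis
        using interp_ge_same[of 1 x] U.in_closure W.bounds(1)[OF True] U.p by (auto intro!: powr_mono2)
    qed simp
  qed (use U.p in auto)
  also have "\<dots> \<le> power_mass \<Omega> (p + 1) (\<lambda>x. - u x)"
    by (rule mass_interp_le) auto
  finally show ?thesis .
qed

lemma mass_eq: "power_mass \<Omega> (p + 1) (\<lambda>x. - w x) = power_mass \<Omega> (p + 1) (\<lambda>x. - u x)"
  by (rule antisym[OF mass_w_le solution_pair.mass_w_le[OF swap]])

text \<open>The equality case: Prekopa-Leindler only needs the supremal convolution \<open>G\<close> with geometric means, which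
  lies below the one with arithmetic means but has at least the same mass.\<close>

lemma geometric_mean_attained:
  assumes z: "z \<in> \<Omega>"
  obtains x y where "x \<in> closure \<Omega>" "y \<in> closure \<Omega>" "z = (1 / 2) *\<^sub>R (x + y)" "sqrt (u x * w y) = interp (1/2) z"
proof -
  define a where "a x = (if x \<in> closure \<Omega> then - u x else 0)" for x
  define b where "b x = (if x \<in> closure \<Omega> then - w x else 0)" for x
  \<comment> \<open>Zero boundary values make the extension by zero continuous on the whole
    space.\<close>
  have ext: "continuous_on UNIV (\<lambda>x. if x \<in> closure \<Omega> then - k x else 0)"
    if "continuous_on (closure \<Omega>) k" "\<And>x. x \<in> frontier \<Omega> \<Longrightarrow> k x = 0" for k :: "'a \<Rightarrow> real"
  proof -
    have "continuous_on (closure \<Omega> \<union> - \<Omega>) (\<lambda>x. if x \<in> closure \<Omega> then - k x else 0)"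
      using that U.open_domain
      by (intro continuous_on_cases) (auto intro!: continuous_intros simp: frontier_def interior_open)
    moreover have "closure \<Omega> \<union> - \<Omega> = UNIV" using closure_subset by auto
    ultimately show ?thesis by simp
  qed
  have ca: "continuous_on UNIV a" and cb: "continuous_on UNIV b"
    unfolding a_def b_def by (rule ext[OF U.cont U.boundary], assumption, rule ext[OF W.cont W.boundary], assumption)
  have a0: "0 \<le> a x" and b0: "0 \<le> b x" for x
    using U.nonpos W.nonpos by (auto simp: a_def b_def)
  obtain R where R: "\<And>x. x \<in> closure \<Omega> \<Longrightarrow> norm x \<le> R"
    using compact_imp_bounded[OF U.compact_closure_domain] unfolding bounded_iff by blast
  have R0: "0 \<le> R" using R[OF U.in_closure[OF z]] norm_ge_zero order_trans by blast
  \<comment> \<open>The pairs with midpoint \<open>z\<close> are \<open>z + h\<close> and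
    \<open>z - h\<close>. For points of the domain the half difference has norm at most
    \<open>R\<close>, so the supremum runs over a compact ball and is attained.\<close>
  define g where "g h z = sqrt (a (z + h) * b (z - h))" for h z
  define G where "G z = (SUP h\<in>cball 0 R. g h z)" for z
  have cg: "continuous_on UNIV (\<lambda>(h, z). g h z)"
    unfolding g_def case_prod_unfold
    by (intro continuous_intros continuous_on_compose2[OF ca] continuous_on_compose2[OF cb]) auto
  have attained: "\<exists>h\<in>cball 0 R. G z = g h z \<and> (\<forall>h'\<in>cball 0 R. g h' z \<le> g h z)" for z
  proof -
    have "continuous_on (cball 0 R) (\<lambda>h. g h z)"
      unfolding g_def by (intro continuous_intros continuous_on_compose2[OF ca] continuous_on_compose2[OF cb]) auto
    then obtain h where h: "h \<in> cball 0 R" "\<forall>h'\<in>cball 0 R. g h' z \<le> g h z"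
      using continuous_attains_sup[of "cball 0 R" "\<lambda>h. g h z"] R0 by auto
    then have "G z = g h z" unfolding G_def by (intro cSup_eq_maximum) auto
    then show ?thesis using h by blast
  qed
  have G_ge: "g h z \<le> G z" if "h \<in> cball 0 R" for h z
    using attained[of z] that by auto
  \<comment> \<open>The set is the projection of a closed set along a compact factor. This upper
    semicontinuity gives both measurability of \<open>G\<close> and, later, openness of the set
    where \<open>G\<close> is too small.\<close>
  have closed_G: "closed {z. r \<le> G z}" for r
  proof -
    have "closed {y. \<exists>h. h \<in> cball 0 R \<and> (h, y) \<in> {q :: 'a \<times> 'a. r \<le> g (fst q) (snd q)}}"
      using cg by (intro closed_compact_projection closed_Collect_le) (auto simp: case_prod_unfold)
    moreover have "{y. \<exists>h. h \<in> cball 0 R \<and> (h, y) \<in> {q :: 'a \<times> 'a. r \<le> g (fst q) (snd q)}} = {z. r \<le> G z}"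
      using attained G_ge by auto (metis order_trans mem_cball_0)+
    ultimately show ?thesis by simp
  qed
  then have G_borel [measurable]: "G \<in> borel_measurable borel"
    unfolding borel_measurable_iff_ge by auto
  have G_nonneg: "0 \<le> G z" for z
    using attained[of z] a0 b0 by (auto simp: g_def)
  let ?I = "interp (1/2)"
  have amgm: "sqrt (- u x * - w y) \<le> ?I z" if "x \<in> closure \<Omega>" "y \<in> closure \<Omega>" "z = (1 / 2) *\<^sub>R (x + y)" for x y z
  proof -
    have "sqrt (- u x * - w y) \<le> (- u x + - w y) / 2"
      using U.nonpos[OF that(1)] W.nonpos[OF that(2)] by (intro arith_geo_mean_sqrt) auto
    also have "\<dots> = (1 - 1/2) * (- u x) + 1/2 * (- w y)" by simp
    also have "\<dots> \<le> ?I ((1 - 1/2) *\<^sub>R x + (1/2) *\<^sub>R y)"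
      using that by (intro interp_ge) auto
    also have "(1 - 1/2) *\<^sub>R x + (1/2) *\<^sub>R y = z" using that by (simp add: scaleR_add_right)
    finally show ?thesis .
  qed
  have mid: "z = (1 / 2) *\<^sub>R ((z + h) + (z - h))" for z h :: 'a
    by (simp flip: scaleR_2)
  have G_le: "G z \<le> ?I z" if z: "z \<in> \<Omega>" for z
  proof -
    obtain h where h: "G z = g h z" using attained by blast
    show ?thesis
    proof (cases "z + h \<in> closure \<Omega> \<and> z - h \<in> closure \<Omega>")
      case True
      then show ?thesis using amgm[OF _ _ mid, of z h] by (simp add: h g_def a_def b_def)
    next
      case False
      then show ?thesis using interp_pos[of "1/2" z] z by (auto simp: h g_def a_def b_def)
    qed
  qed
  have G_ge': "sqrt (u x * w y) \<le> G ((1 / 2) *\<^sub>R (x + y))" if x: "x \<in> \<Omega>" and y: "y \<in> \<Omega>" for x y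
  proof -
    let ?h = "(1 / 2) *\<^sub>R (x - y)"
    have "norm (x - y) \<le> R + R"
      using R[OF U.in_closure[OF x]] R[OF U.in_closure[OF y]] norm_triangle_ineq4[of x y] by linarith
    then have "?h \<in> cball 0 R" by simp
    from G_ge[OF this, of "(1 / 2) *\<^sub>R (x + y)"]
    have "g ?h ((1 / 2) *\<^sub>R (x + y)) \<le> G ((1 / 2) *\<^sub>R (x + y))" .
    moreover have "(1 / 2) *\<^sub>R (x + y) + ?h = x" "(1 / 2) *\<^sub>R (x + y) - ?h = y"
      by (simp_all add: scaleR_add_right scaleR_diff_right flip: scaleR_add_left)
    ultimately show ?thesis using U.in_closure x y by (simp add: g_def a_def b_def)
  qed
  have q: "0 \<le> p + 1" "0 < p + 1" using U.p by auto
  have mG: "(\<lambda>x. indicator \<Omega> x * G x powr (p + 1)) \<in> borel_measurable borel"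
  proof -
    have [measurable]: "\<Omega> \<in> sets borel" using U.open_domain by simp
    show ?thesis by measurable
  qed
  have G_int: "integrable lborel (\<lambda>x. indicator \<Omega> x * G x powr (p + 1))"
  proof (rule U.integrable_domain_bounded[OF mG])
    fix x assume "x \<in> \<Omega>"
    then show "\<bar>G x powr (p + 1)\<bar> \<le> depth_sum powr (p + 1)"
      using G_nonneg G_le interp_le_K[of "1/2" x] U.in_closure U.p
      by (auto intro!: powr_mono2 intro: order_trans)
  qed
  have I_int: "integrable lborel (\<lambda>x. indicator \<Omega> x * ?I x powr (p + 1))"
    using q by (intro interp_power_integrable) auto
  \<comment> \<open>As the endpoint masses coincide, \<open>G\<close> has at least that mass;
    \<open>interp (1/2)\<close> has at most that mass and lies above \<open>G\<close>, so the two
    agree almost everywhere.\<close>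
  have "power_mass \<Omega> (p + 1) (\<lambda>x. - u x) powr (1 - 1/2) * power_mass \<Omega> (p + 1) (\<lambda>x. - w x) powr (1/2)
      \<le> power_mass \<Omega> (p + 1) G"
  proof (rule U.power_mass_prekopa_leindler[OF U.density_borel W.density_borel mG q(2), where C = depth_sum])
    fix x assume x: "x \<in> \<Omega>"
    show "0 \<le> - u x" "- u x \<le> depth_sum" "0 \<le> - w x" "- w x \<le> depth_sum" "0 \<le> G x" "G x \<le> depth_sum"
      using U.bounds[OF x] W.bounds[OF x] depth_sum G_nonneg G_le[OF x] interp_le_K[of "1/2" x] U.in_closure[OF x] by auto
    fix y assume y: "y \<in> \<Omega>"
    have "(- u x) powr (1 - 1/2) * (- w y) powr (1/2) = sqrt (u x * w y)"
      using U.bounds(1)[OF x] W.bounds(1)[OF y] by (simp add: powr_half_sqrt flip: real_sqrt_mult)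
    then show "(- u x) powr (1 - 1/2) * (- w y) powr (1/2) \<le> G ((1 - 1/2) *\<^sub>R x + (1/2) *\<^sub>R y)"
      using G_ge'[OF x y] by (simp add: scaleR_add_right)
  qed auto
  also have "power_mass \<Omega> (p + 1) (\<lambda>x. - u x) powr (1 - 1/2) * power_mass \<Omega> (p + 1) (\<lambda>x. - w x) powr (1/2)
      = power_mass \<Omega> (p + 1) (\<lambda>x. - u x)"
    using mass_eq U.power_mass_pos[OF q(1)] by (simp flip: powr_add)
  finally have "power_mass \<Omega> (p + 1) ?I \<le> power_mass \<Omega> (p + 1) G"
    using mass_interp_le[of "1/2"] by simp
  then have "(\<integral>x. indicator \<Omega> x * ?I x powr (p + 1) - indicator \<Omega> x * G x powr (p + 1) \<partial>lborel) \<le> 0"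
    using G_int I_int by (simp add: power_mass_def)
  moreover have nn: "0 \<le> indicator \<Omega> x * ?I x powr (p + 1) - indicator \<Omega> x * G x powr (p + 1)" for x
    using G_le[of x] G_nonneg[of x] q by (cases "x \<in> \<Omega>") (auto intro!: powr_mono2)
  ultimately have "(\<integral>x. indicator \<Omega> x * ?I x powr (p + 1) - indicator \<Omega> x * G x powr (p + 1) \<partial>lborel) = 0"
    by (intro antisym Bochner_Integration.integral_nonneg)
  then have ae: "AE x in lborel. indicator \<Omega> x * ?I x powr (p + 1) - indicator \<Omega> x * G x powr (p + 1) = 0"
    using integral_nonneg_eq_0_iff_AE[OF Bochner_Integration.integrable_diff[OF I_int G_int]] nn by simp
  have "G z = ?I z"
  proof (rule ccontr)
    assume "G z \<noteq> ?I z"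
    then obtain r where r: "G z < r" "r < ?I z"
      using G_le[OF z] dense[of "G z" "?I z"] by auto
    \<comment> \<open>An intermediate height \<open>r\<close> makes the failure set open, so almost
      everywhere agreement becomes agreement everywhere.\<close>
    define E where "E = {x \<in> \<Omega>. r < ?I x} \<inter> - {x. r \<le> G x}"
    have "open E"
      unfolding E_def using closed_G
      by (intro open_Int U.open_Collect_less_domain continuous_intros interp_continuous) auto
    moreover have "z \<in> E" using r z by (auto simp: E_def)
    ultimately have "\<not> negligible E" by (intro open_not_negligible) auto
    moreover have "AE x in lborel. x \<notin> E"
      using ae
    proof eventually_elim
      case (elim x)
      show ?case
      proof
        assume x: "x \<in> E"
        then have "G x powr (p + 1) < ?I x powr (p + 1)"
          using q G_nonneg[of x] by (intro powr_less_mono2) (auto simp: E_def)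
        then show False using elim x by (simp add: E_def)
      qed
    qed
    then have "E \<in> null_sets lborel"
      using \<open>open E\<close> by (intro AE_iff_null_sets[THEN iffD2]) auto
    ultimately show False by (simp add: negligible_iff_null_sets null_sets_completionI)
  qed
  moreover obtain h where h: "G z = g h z" using attained by blast
  ultimately have eq: "g h z = ?I z" by simp
  have "0 < ?I z" using z by (intro interp_pos) auto
  \<comment> \<open>Off the closure the extended functions are 0, which the positive value
    excludes.\<close>
  then have "z + h \<in> closure \<Omega>" "z - h \<in> closure \<Omega>"
    using eq by (auto simp: g_def a_def b_def split: if_splits)
  moreover from this have "sqrt (u (z + h) * w (z - h)) = ?I z"
    using eq by (simp add: g_def a_def b_def)
  ultimately show ?thesis using that mid by blast
qed

end

section \<open>Uniqueness\<close>

context solution_pair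
begin

text \<open>Arbitrary contact points need not have equal heights, but their midpoint
  \<open>z\<close> has a second decomposition in which \<open>interp (1/2) z\<close> is a geometric
  mean. That pair has equal heights, and it does at least as well for slope \<open>y\<close> as the
  original pair, so it consists of contact points too.\<close>

lemma equal_height_contact:
  obtains x0 x1 where "x0 \<in> closure \<Omega>" "conjugate \<Omega> u y = x0 \<bullet> y - u x0"
    "x1 \<in> closure \<Omega>" "conjugate \<Omega> w y = x1 \<bullet> y - w x1" "u x0 = w x1"
proof -
  obtain x0 where x0: "x0 \<in> closure \<Omega>" "conjugate \<Omega> u y = x0 \<bullet> y - u x0"
    by (rule U.conjugate_attained)
  obtain x1 where x1: "x1 \<in> closure \<Omega>" "conjugate \<Omega> w y = x1 \<bullet> y - w x1"
    by (rule W.conjugate_attained)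
  define z where "z = (1 / 2) *\<^sub>R (x0 + x1)"
  have z': "z = (1 - 1/2) *\<^sub>R x0 + (1/2) *\<^sub>R x1" by (simp add: z_def scaleR_add_right)
  have z_cl: "z \<in> closure \<Omega>"
    unfolding z' using x0 x1 by (intro closure_convex_comb) auto
  show ?thesis
  proof (cases "z \<in> \<Omega>")
    case True
    obtain v0 v1 where v: "v0 \<in> closure \<Omega>" "v1 \<in> closure \<Omega>" "z = (1 / 2) *\<^sub>R (v0 + v1)"
      "sqrt (u v0 * w v1) = interp (1/2) z"
      using geometric_mean_attained[OF True] by metis
    have zy: "z \<bullet> y = (v0 \<bullet> y + v1 \<bullet> y) / 2"
      by (subst v(3)) (simp add: inner_add_left)
    have zy': "z \<bullet> y = (x0 \<bullet> y + x1 \<bullet> y) / 2"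
      by (subst z_def) (simp add: inner_add_left)
    have "(1 - 1/2) * (- u v0) + 1/2 * (- w v1) \<le> interp (1/2) ((1 - 1/2) *\<^sub>R v0 + (1/2) *\<^sub>R v1)"
      using v by (intro interp_ge) auto
    also have "(1 - 1/2) *\<^sub>R v0 + (1/2) *\<^sub>R v1 = z" using v(3) by (simp add: scaleR_add_right)
    finally have le: "(- u v0 + - w v1) / 2 \<le> sqrt (u v0 * w v1)" using v(4) by simp
    have nonneg: "0 \<le> - u v0" "0 \<le> - w v1" using U.nonpos W.nonpos v by auto
    \<comment> \<open>The arithmetic mean does not exceed the geometric mean, hence the two heights
      are equal.\<close>
    have "(sqrt (- u v0) - sqrt (- w v1))\<^sup>2 = (- u v0 + - w v1) - 2 * sqrt (u v0 * w v1)"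
      using nonneg by (simp add: power2_diff flip: real_sqrt_mult)
    then have "(sqrt (- u v0) - sqrt (- w v1))\<^sup>2 \<le> 0" using le by simp
    then have eq: "u v0 = w v1" by simp
    then have I: "interp (1/2) z = - u v0"
      using v(4) nonneg by (simp add: real_sqrt_mult_self flip: power2_eq_square)
    have "(1 - 1/2) * (- u x0) + 1/2 * (- w x1) \<le> interp (1/2) z"
      unfolding z' using x0 x1 by (intro interp_ge) auto
    then have "(- u x0 + - w x1) / 2 \<le> - u v0" using I by simp
    \<comment> \<open>Each term on the right is at most its conjugate, so the inequality for the sum
      forces both to be attained.\<close>
    then have sum: "conjugate \<Omega> u y + conjugate \<Omega> w y \<le> (v0 \<bullet> y - u v0) + (v1 \<bullet> y - w v1)"
      using x0(2) x1(2) zy zy' eq by simp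
    have "v0 \<bullet> y - u v0 \<le> conjugate \<Omega> u y" "v1 \<bullet> y - w v1 \<le> conjugate \<Omega> w y"
      using v U.conjugate_ge W.conjugate_ge by auto
    then show ?thesis using sum v eq by (intro that[of v0 v1]) auto
  next
    case False
    \<comment> \<open>If one endpoint were interior, so would be the midpoint; hence both contact
      points lie on the boundary, at height 0.\<close>
    have "x0 \<notin> \<Omega>"
    proof
      assume "x0 \<in> \<Omega>"
      then have "x1 - (1/2) *\<^sub>R (x1 - x0) \<in> interior \<Omega>"
        using x1 U.open_domain U.convex_domain by (intro mem_interior_closure_convex_shrink) (auto simp: interior_open)
      moreover have "x1 - (1/2) *\<^sub>R (x1 - x0) = z"
        by (simp add: z_def algebra_simps flip: scaleR_add_left)
      ultimately show False using False interior_subset by auto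
    qed
    moreover have "x1 \<notin> \<Omega>"
    proof
      assume "x1 \<in> \<Omega>"
      then have "x0 - (1/2) *\<^sub>R (x0 - x1) \<in> interior \<Omega>"
        using x0 U.open_domain U.convex_domain by (intro mem_interior_closure_convex_shrink) (auto simp: interior_open)
      moreover have "x0 - (1/2) *\<^sub>R (x0 - x1) = z"
        by (simp add: z_def algebra_simps flip: scaleR_add_left)
      ultimately show False using False interior_subset by auto
    qed
    ultimately have "u x0 = 0" "w x1 = 0"
      using U.closure_cases[OF x0(1)] U.closure_cases[OF x1(1)] U.boundary W.boundary by metis+
    then show ?thesis using x0 x1 by (intro that[of x0 x1]) auto
  qed
qed

text \<open>A contact point \<open>x\<close> for slope \<open>y /\<^sub>R r\<close>, with contact
  height \<open>m r\<close>, supports the perspective at \<open>r\<close> by the affine function of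
  \<open>r'\<close> with value \<open>x \<bullet> y + r' * m r\<close>. Its slope is common to
  \<open>u\<close> and \<open>w\<close> even if their contact points differ, and boundedness of the
  difference of the conjugates gives the condition near 0.\<close>

lemma conjugate_eq: "conjugate \<Omega> u y = conjugate \<Omega> w y"
proof -
  have "\<exists>h. \<exists>x0\<in>closure \<Omega>. \<exists>x1\<in>closure \<Omega>. conjugate \<Omega> u v = x0 \<bullet> v + h \<and> conjugate \<Omega> w v = x1 \<bullet> v + h
      \<and> u x0 = - h \<and> w x1 = - h" for v
    using equal_height_contact[of v] by (metis add.inverse_inverse diff_conv_add_uminus)
  then obtain h where h: "\<And>v. \<exists>x0\<in>closure \<Omega>. \<exists>x1\<in>closure \<Omega>. conjugate \<Omega> u v = x0 \<bullet> v + h v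
      \<and> conjugate \<Omega> w v = x1 \<bullet> v + h v \<and> u x0 = - h v \<and> w x1 = - h v"
    by metis
  define f where "f r = r * conjugate \<Omega> u (y /\<^sub>R r)" for r
  define g where "g r = r * conjugate \<Omega> w (y /\<^sub>R r)" for r
  define m where "m r = h (y /\<^sub>R r)" for r
  have "f 1 = g 1"
  proof (rule eq_of_common_subgradient[where m = m and B = depth_sum and D = depth_sum])
    fix r r' :: real assume r: "0 < r" "0 < r'"
    obtain x0 x1 where x: "x0 \<in> closure \<Omega>" "x1 \<in> closure \<Omega>" "conjugate \<Omega> u (y /\<^sub>R r) = x0 \<bullet> (y /\<^sub>R r) + m r"
      "conjugate \<Omega> w (y /\<^sub>R r) = x1 \<bullet> (y /\<^sub>R r) + m r" "u x0 = - m r" "w x1 = - m r"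
      using h[of "y /\<^sub>R r"] unfolding m_def by blast
    have "r' * (x0 \<bullet> (y /\<^sub>R r') - u x0) \<le> f r'"
      unfolding f_def using r x by (intro mult_left_mono U.conjugate_ge) auto
    then have 1: "x0 \<bullet> y + r' * m r \<le> f r'" using r x by (simp add: distrib_left flip: mult.assoc)
    have 2: "f r = x0 \<bullet> y + r * m r" unfolding f_def x(3) using r by (simp add: distrib_left flip: mult.assoc)
    show "f r + m r * (r' - r) \<le> f r'" using 1 2 by (simp add: algebra_simps)
    have "r' * (x1 \<bullet> (y /\<^sub>R r') - w x1) \<le> g r'"
      unfolding g_def using r x by (intro mult_left_mono W.conjugate_ge) auto
    then have 3: "x1 \<bullet> y + r' * m r \<le> g r'" using r x by (simp add: distrib_left flip: mult.assoc)
    have 4: "g r = x1 \<bullet> y + r * m r" unfolding g_def x(4) using r by (simp add: distrib_left flip: mult.assoc)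
    show "g r + m r * (r' - r) \<le> g r'" using 3 4 by (simp add: algebra_simps)
  next
    fix r :: real
    show "0 \<le> m r"
      using h[of "y /\<^sub>R r"] U.nonpos unfolding m_def by fastforce
    assume r: "0 < r"
    have "\<bar>f r - g r\<bar> = r * \<bar>conjugate \<Omega> w (y /\<^sub>R r) - conjugate \<Omega> u (y /\<^sub>R r)\<bar>"
      using r by (simp add: f_def g_def abs_mult abs_minus_commute flip: right_diff_distrib)
    also have "\<dots> \<le> r * depth_sum" using r conjugate_diff_bound by (intro mult_left_mono) auto
    finally show "\<bar>f r - g r\<bar> \<le> r * depth_sum" .
  next
    obtain x where "x \<in> closure \<Omega>" "u x = - m 1" using h[of y] unfolding m_def by auto
    then show "m 1 \<le> depth_sum" using U.depth(2)[of x] depth_sum by auto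
  qed
  then show ?thesis by (simp add: f_def g_def)
qed

text \<open>A subgradient \<open>y\<close> of \<open>w\<close> at a point \<open>v\<close> with
  \<open>u v < w v\<close> would make the conjugate of \<open>u\<close> at \<open>y\<close> strictly
  larger than that of \<open>w\<close>.\<close>

lemma le_solution: "x \<in> \<Omega> \<Longrightarrow> w x \<le> u x"
proof (rule ccontr)
  assume x: "x \<in> \<Omega>" "\<not> w x \<le> u x"
  define E where "E = {x \<in> \<Omega>. u x < w x}"
  have "open E" unfolding E_def by (intro U.open_Collect_less_domain U.continuous_domain W.continuous_domain)
  then have "0 < emeasure lebesgue (subdifferential_image \<Omega> w E)"
    using x by (intro W.subdifferential_image_pos) (auto simp: E_def)
  then have "subdifferential_image \<Omega> w E \<noteq> {}" by (metis emeasure_empty less_irrefl)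
  then obtain v y where v: "v \<in> E" "y \<in> subdifferential \<Omega> w v"
    by (auto simp: subdifferential_image_def)
  then have "v \<in> \<Omega>" "u v < w v" by (auto simp: E_def)
  then show False
    using U.conjugate_ge[OF U.in_closure, of v y] W.conjugate_subdifferential[OF _ v(2)] conjugate_eq[of y]
    by simp
qed

lemma solution_eq: "x \<in> closure \<Omega> \<Longrightarrow> u x = w x"
  using le_solution solution_pair.le_solution[OF swap] U.boundary W.boundary U.closure_cases by (metis antisym)

lemma coefficient_eq: "c0 = c1"
proof -
  have "subdifferential \<Omega> u x = subdifferential \<Omega> w x" if "x \<in> \<Omega>" for x
    using that by (auto simp: subdifferential_def solution_eq U.in_closure)
  then have "subdifferential_image \<Omega> u \<Omega> = subdifferential_image \<Omega> w \<Omega>"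
    by (auto simp: subdifferential_image_def)
  then have "ennreal (c0 * power_mass \<Omega> p (\<lambda>x. - u x)) = ennreal (c1 * power_mass \<Omega> p (\<lambda>x. - w x))"
    using U.total_measure W.total_measure by simp
  moreover have "power_mass \<Omega> p (\<lambda>x. - u x) = power_mass \<Omega> p (\<lambda>x. - w x)"
    unfolding power_mass_def
    by (intro Bochner_Integration.integral_cong) (auto simp: indicator_def solution_eq U.in_closure)
  moreover have "0 < power_mass \<Omega> p (\<lambda>x. - u x)" using U.p by (intro U.power_mass_pos) simp
  ultimately show ?thesis using U.c W.c by simp
qed

end

section \<open>Normalising by a dilation and recovering the factor\<close>

theorem theorem1p1:
  fixes \<Omega> :: "(real ^ 'n) set" and p :: real and u0 u1 :: "real ^ 'n \<Rightarrow> real"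
  assumes "CARD('n) \<ge> 2"
    and "convex_domain \<Omega>" and "bounded \<Omega>"
    and "p > real CARD('n)"
    and "continuous_on (closure \<Omega>) u0" and "continuous_on (closure \<Omega>) u1"
    and "alexandrov_solution \<Omega> (\<lambda>x. (- u0 x) powr p) u0"
    and "alexandrov_solution \<Omega> (\<lambda>x. (- u1 x) powr p) u1"
    and "\<forall>x\<in>frontier \<Omega>. u0 x = 0" and "\<forall>x\<in>frontier \<Omega>. u1 x = 0"
    and "\<exists>x\<in>closure \<Omega>. u0 x \<noteq> 0" and "\<exists>x\<in>closure \<Omega>. u1 x \<noteq> 0"
  shows "\<forall>x\<in>closure \<Omega>. u0 x = u1 x"
proof -
  have p: "1 < p" using assms(1,4) by linarith
  interpret U: power_solution \<Omega> p 1 u0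
    using assms p by unfold_locales auto
  interpret V: power_solution \<Omega> p 1 u1
    using assms p by unfold_locales auto
  define n where "n = CARD('n)"
  \<comment> \<open>The root of order n + 1 matches the homogeneity of the conjugate volume under
    multiplication of the function by \<open>r\<close>.\<close>
  define r where "r = root (Suc n) (conjugate_volume \<Omega> u0 / conjugate_volume \<Omega> u1)"
  have r: "0 < r"
    using U.conjugate_volume_pos V.conjugate_volume_pos by (simp add: r_def)
  have rn: "r ^ Suc n * conjugate_volume \<Omega> u1 = conjugate_volume \<Omega> u0"
    using U.conjugate_volume_pos V.conjugate_volume_pos by (simp add: r_def real_root_pow_pos2 del: power_Suc)
  interpret W: power_solution \<Omega> p "1 * (r ^ DIM(real ^ 'n) * r powr (- p))" "\<lambda>x. r * u1 x"
    by (rule V.power_solution_scale[OF r])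
  interpret solution_pair \<Omega> p 1 "1 * (r ^ DIM(real ^ 'n) * r powr (- p))" u0 "\<lambda>x. r * u1 x"
    using V.conjugate_volume_scale[OF r] rn by unfold_locales (simp add: n_def)
  \<comment> \<open>The multiple of \<open>u1\<close> carries the factor r^(n-p), which must equal
    the factor 1 of \<open>u0\<close>; as n - p is nonzero, \<open>r\<close> is 1.\<close>
  have "1 = r powr (real n - p)"
    using coefficient_eq r by (simp add: n_def powr_diff powr_minus powr_realpow field_simps)
  from arg_cong[OF this, of ln] have "(real n - p) * ln r = 0"
    using r by simp
  then have "r = 1" using r assms(4) by (simp add: n_def)
  then show ?thesis using solution_eq by simp
qed

end
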